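(* Suppose that $\phi$ is an essentially linear fractional selfmap of $\mathbb{U}$ of hyperbolic type with Denjoy-Wolff point $1$. Then, for the composition operator $C_\phi: H^2(\mathbb{U})\to H^2(\mathbb{U})$, $$\mathrm{Sp}(C_\phi) = \mathrm{Sp}_e(C_\phi) = \{z\in\mathbb{C}: |z| \le \phi'(1)^{-1/2}\}.$$
   Context: $\mathbb{U}$ is the open unit disc in $\mathbb{C}$ and $H^2(\mathbb{U})$ is the classical Hardy space of analytic functions on $\mathbb{U}$ with square-summable Maclaurin coefficients. An (analytic) selfmap of $\mathbb{U}$ is an analytic function $\phi$ on $\mathbb{U}$ with $\phi(\mathbb{U})\subseteq\mathbb{U}$; $C_\phi f = f\circ\phi$ is the composition operator, which is bounded on $H^2(\mathbb{U})$. For a bounded operator $T$ on a Hilbert space, $\mathrm{Sp}(T)$ is its spectrum and $\mathrm{Sp}_e(T)$ is its essential spectrum, $\{\lambda : T-\lambda I \text{ is not Fredholm}\}$. A selfmap $\phi$ is essentially linear fractional if there is $\eta\in\partial\mathbb{U}$ such that: (a) $\phi(\mathbb{U})$ is contained in a proper subdisc of $\mathbb{U}$ internally tangent to the unit circle at $\eta$; (b) the set $\phi^{-1}(\{\eta\}) := \{\zeta\in\partial\mathbb{U} : \eta \text{ belongs to the cluster set of } \phi \text{ at } \zeta\}$ consists of exactly one element, say $\zeta_0$; (c) $\phi'''$ extends continuously to $\mathbb{U}\cup\{\zeta_0\}$. Consequently $\phi,\phi',\phi''$ also extend continuously to $\zeta_0$, and values at $\zeta_0$ denote values of these extensions. If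 $\phi$ fixes the boundary point $1$, then $\eta=\zeta_0=1$. Denjoy-Wolff point: if $\phi$ is not an elliptic automorphism of $\mathbb{U}$, there is a unique $\omega$ in the closed disc with $\phi^{[n]}(z)\to\omega$ for each $z\in\mathbb{U}$, where $\phi^{[n]}$ is the $n$-th iterate; it is the Denjoy-Wolff point. If $|\omega|=1$, then $\phi(\omega)=\omega$ as an angular limit and the angular derivative satisfies $0<\phi'(\omega)\le 1$. The map $\phi$ is of hyperbolic type if $\omega\in\partial\mathbb{U}$ and $\phi'(\omega)<1$. *)

theory Defs
  imports "HOL-Complex_Analysis.Complex_Analysis"
begin

section \<open>Complex normed spaces, spectrum and essential spectrum\<close>

class complex_normed_vector = real_normed_vector +
  fixes scaleC :: "complex \<Rightarrow> 'a \<Rightarrow> 'a" (infixr "*\<^sub>C" 75)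
  assumes scaleC_add_right: "a *\<^sub>C (x + y) = a *\<^sub>C x + a *\<^sub>C y"
    and scaleC_add_left: "(a + b) *\<^sub>C x = a *\<^sub>C x + b *\<^sub>C x"
    and scaleC_scaleC: "a *\<^sub>C b *\<^sub>C x = (a * b) *\<^sub>C x"
    and scaleC_of_real: "complex_of_real r *\<^sub>C x = r *\<^sub>R x"
    and norm_scaleC: "norm (a *\<^sub>C x) = cmod a * norm x"

lemma scaleC_one: "1 *\<^sub>C x = (x :: 'a::complex_normed_vector)"
  using scaleC_of_real[of 1 x] by simp

global_interpretation complex_vector:
  vector_space "scaleC :: complex \<Rightarrow> 'a \<Rightarrow> 'a::complex_normed_vector"
  defines cspan = complex_vector.span
  by unfold_locales (simp_all add: scaleC_add_right scaleC_add_left scaleC_scaleC scaleC_one)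

definition bounded_clinear ::
    "('a::complex_normed_vector \<Rightarrow> 'b::complex_normed_vector) \<Rightarrow> bool" where
  "bounded_clinear T \<longleftrightarrow> bounded_linear T \<and> (\<forall>c x. T (c *\<^sub>C x) = c *\<^sub>C T x)"

definition op_minus :: "('a::complex_normed_vector \<Rightarrow> 'a) \<Rightarrow> complex \<Rightarrow> 'a \<Rightarrow> 'a" where
  "op_minus T \<mu> = (\<lambda>x. T x - \<mu> *\<^sub>C x)"

definition op_invertible :: "('a::complex_normed_vector \<Rightarrow> 'a) \<Rightarrow> bool" where
  "op_invertible T \<longleftrightarrow>
     bounded_clinear T \<and> (\<exists>S. bounded_clinear S \<and> S \<circ> T = id \<and> T \<circ> S = id)"

definition Sp :: "('a::complex_normed_vector \<Rightarrow> 'a) \<Rightarrow> complex set" where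
  "Sp T = {\<mu>. \<not> op_invertible (op_minus T \<mu>)}"

text \<open>Closed range, finite-dimensional kernel, and range of finite codimension.\<close>

definition Fredholm :: "('a::complex_normed_vector \<Rightarrow> 'a) \<Rightarrow> bool" where
  "Fredholm T \<longleftrightarrow>
     bounded_clinear T \<and> closed (range T) \<and>
     (\<exists>B. finite B \<and> {x. T x = 0} \<subseteq> cspan B) \<and>
     (\<exists>B. finite B \<and> (\<forall>y. \<exists>x. y - T x \<in> cspan B))"

definition Sp_ess :: "('a::complex_normed_vector \<Rightarrow> 'a) \<Rightarrow> complex set" where
  "Sp_ess T = {\<mu>. \<not> Fredholm (op_minus T \<mu>)}"


section \<open>The Hardy space of the unit disc\<close>

abbreviation unit_disc :: "complex set" where
  "unit_disc \<equiv> ball 0 1"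

definition maclaurin :: "(complex \<Rightarrow> complex) \<Rightarrow> nat \<Rightarrow> complex" where
  "maclaurin f n = (deriv ^^ n) f 0 / fact n"

text \<open>
  Functions on the disc are represented by total functions vanishing off the disc,
  so that equality in the type is equality on the disc.
\<close>

definition in_hardy2 :: "(complex \<Rightarrow> complex) \<Rightarrow> bool" where
  "in_hardy2 f \<longleftrightarrow> f holomorphic_on unit_disc \<and> (\<forall>z. z \<notin> unit_disc \<longrightarrow> f z = 0) \<and>
     summable (\<lambda>n. (cmod (maclaurin f n))\<^sup>2)"

lemma maclaurin_add:
  assumes "f holomorphic_on unit_disc" "g holomorphic_on unit_disc"
  shows "maclaurin (\<lambda>z. f z + g z) n = maclaurin f n + maclaurin g n"
  unfolding maclaurin_def using higher_deriv_add[OF assms, of 0 n] by (simp add: add_divide_distrib)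

lemma maclaurin_cmult:
  assumes "f holomorphic_on unit_disc"
  shows "maclaurin (\<lambda>z. c * f z) n = c * maclaurin f n"
  unfolding maclaurin_def using higher_deriv_cmult[OF assms, of 0 n c] by simp

lemma maclaurin_zero: "maclaurin (\<lambda>z. 0) n = 0"
  by (simp add: maclaurin_def)

lemma in_hardy2_zero: "in_hardy2 (\<lambda>z. 0)"
  by (simp add: in_hardy2_def maclaurin_zero)

lemma in_hardy2_add:
  assumes "in_hardy2 f" "in_hardy2 g"
  shows "in_hardy2 (\<lambda>z. f z + g z)"
proof -
  have *: "(cmod (a + b))\<^sup>2 \<le> 2 * (cmod a)\<^sup>2 + 2 * (cmod b)\<^sup>2" for a b
  proof -
    have "(cmod (a + b))\<^sup>2 \<le> (cmod a + cmod b)\<^sup>2"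
      by (intro power_mono norm_triangle_ineq) simp
    also have "\<dots> \<le> 2 * (cmod a)\<^sup>2 + 2 * (cmod b)\<^sup>2"
      using zero_le_power2[of "cmod a - cmod b"] by (simp add: power2_eq_square algebra_simps)
    finally show ?thesis .
  qed
  have "summable (\<lambda>n. 2 * (cmod (maclaurin f n))\<^sup>2 + 2 * (cmod (maclaurin g n))\<^sup>2)"
    using assms unfolding in_hardy2_def by (intro summable_add summable_mult) auto
  then have "summable (\<lambda>n. (cmod (maclaurin f n + maclaurin g n))\<^sup>2)"
    by (rule summable_comparison_test[rotated]) (use * in auto)
  then show ?thesis
    using assms by (auto simp: in_hardy2_def maclaurin_add intro: holomorphic_intros)
qed

lemma in_hardy2_cmult:
  assumes "in_hardy2 f"
  shows "in_hardy2 (\<lambda>z. c * f z)"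
  using assms
  by (auto simp: in_hardy2_def maclaurin_cmult norm_mult power_mult_distrib
      intro!: holomorphic_intros summable_mult)

typedef hardy2 = "{f. in_hardy2 f}" morphisms fun_of Abs_hardy2
  using in_hardy2_zero by blast

setup_lifting type_definition_hardy2

lemma in_hardy2_fun_of: "in_hardy2 (fun_of f)"
  using fun_of by simp

lemma holomorphic_fun_of: "fun_of f holomorphic_on unit_disc"
  using in_hardy2_fun_of[of f] by (simp add: in_hardy2_def)

lemma summable_fun_of: "summable (\<lambda>n. (cmod (maclaurin (fun_of f) n))\<^sup>2)"
  using in_hardy2_fun_of[of f] by (simp add: in_hardy2_def)

instantiation hardy2 :: real_vector
begin

lift_definition zero_hardy2 :: hardy2 is "\<lambda>z. 0"
  by (rule in_hardy2_zero)

lift_definition plus_hardy2 :: "hardy2 \<Rightarrow> hardy2 \<Rightarrow> hardy2" is "\<lambda>f g z. f z + g z"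
  by (rule in_hardy2_add)

lift_definition uminus_hardy2 :: "hardy2 \<Rightarrow> hardy2" is "\<lambda>f z. - f z"
  using in_hardy2_cmult[of _ "-1"] by simp

lift_definition minus_hardy2 :: "hardy2 \<Rightarrow> hardy2 \<Rightarrow> hardy2" is "\<lambda>f g z. f z - g z"
  using in_hardy2_add[OF _ in_hardy2_cmult[of _ "-1"]] by simp

lift_definition scaleR_hardy2 :: "real \<Rightarrow> hardy2 \<Rightarrow> hardy2" is "\<lambda>r f z. complex_of_real r * f z"
  by (rule in_hardy2_cmult)

instance
  by standard (transfer; auto simp: algebra_simps fun_eq_iff)+

end

lemma fun_of_add: "fun_of (f + g) = (\<lambda>z. fun_of f z + fun_of g z)"
  by (rule plus_hardy2.rep_eq)

lemma summable_maclaurin_mult: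
  "summable (\<lambda>n. Re (maclaurin (fun_of f) n * cnj (maclaurin (fun_of g) n)))"
proof (rule summable_comparison_test)
  show "summable (\<lambda>n. (cmod (maclaurin (fun_of f) n))\<^sup>2 + (cmod (maclaurin (fun_of g) n))\<^sup>2)"
    by (intro summable_add summable_fun_of)
  have "\<bar>Re (a * cnj b)\<bar> \<le> (cmod a)\<^sup>2 + (cmod b)\<^sup>2" for a b
  proof -
    have "\<bar>Re (a * cnj b)\<bar> \<le> cmod a * cmod b"
      using abs_Re_le_cmod[of "a * cnj b"] by (simp add: norm_mult)
    also have "\<dots> \<le> 2 * (cmod a * cmod b)"
      by simp
    also have "\<dots> \<le> (cmod a)\<^sup>2 + (cmod b)\<^sup>2"
      using sum_squares_bound[of "cmod a" "cmod b"] by simp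
    finally show ?thesis .
  qed
  then show "\<exists>N. \<forall>n\<ge>N. norm (Re (maclaurin (fun_of f) n * cnj (maclaurin (fun_of g) n)))
      \<le> (cmod (maclaurin (fun_of f) n))\<^sup>2 + (cmod (maclaurin (fun_of g) n))\<^sup>2"
    by simp
qed

text \<open>
  The real inner product is the real part of the usual Hermitian one, so the induced norm is
  the usual one; see \<open>norm_hardy2_eq\<close>.
\<close>

instantiation hardy2 :: real_inner
begin

definition inner_hardy2 :: "hardy2 \<Rightarrow> hardy2 \<Rightarrow> real" where
  "inner_hardy2 f g = (\<Sum>n. Re (maclaurin (fun_of f) n * cnj (maclaurin (fun_of g) n)))"

definition norm_hardy2 :: "hardy2 \<Rightarrow> real" where
  "norm_hardy2 f = sqrt (inner f f)"

definition sgn_hardy2 :: "hardy2 \<Rightarrow> hardy2" where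
  "sgn_hardy2 f = f /\<^sub>R norm f"

definition dist_hardy2 :: "hardy2 \<Rightarrow> hardy2 \<Rightarrow> real" where
  "dist_hardy2 f g = norm (f - g)"

definition uniformity_hardy2 :: "(hardy2 \<times> hardy2) filter" where
  "uniformity_hardy2 = (INF e\<in>{0<..}. principal {(x, y). dist x y < e})"

definition open_hardy2 :: "hardy2 set \<Rightarrow> bool" where
  "open_hardy2 U \<longleftrightarrow> (\<forall>x\<in>U. \<forall>\<^sub>F (x', y) in uniformity. x' = x \<longrightarrow> y \<in> U)"

instance
proof
  fix f g h :: hardy2 and r :: real
  show "inner f g = inner g f"
    by (simp add: inner_hardy2_def algebra_simps)
  show "inner (f + g) h = inner f h + inner g h"
    unfolding inner_hardy2_def
    by (subst suminf_add[OF summable_maclaurin_mult summable_maclaurin_mult])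
      (simp add: fun_of_add maclaurin_add holomorphic_fun_of algebra_simps)
  show "inner (r *\<^sub>R f) g = r * inner f g"
    unfolding inner_hardy2_def
    by (subst suminf_mult[OF summable_maclaurin_mult, symmetric])
      (simp add: scaleR_hardy2.rep_eq maclaurin_cmult holomorphic_fun_of algebra_simps)
  have eq: "Re (a * cnj a) = (cmod a)\<^sup>2" for a
    by (simp only: complex_norm_square[symmetric] Re_complex_of_real)
  show "0 \<le> inner f f"
    unfolding inner_hardy2_def eq by (intro suminf_nonneg summable_fun_of) simp
  show "inner f f = 0 \<longleftrightarrow> f = 0"
  proof
    assume "inner f f = 0"
    then have "\<forall>n. (cmod (maclaurin (fun_of f) n))\<^sup>2 = 0"
      unfolding inner_hardy2_def eq by (subst (asm) suminf_eq_zero_iff[OF summable_fun_of]) auto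
    then have 0: "(deriv ^^ n) (fun_of f) 0 = 0" for n
      by (simp add: maclaurin_def)
    have "fun_of f z = 0" if "z \<in> unit_disc" for z
    proof -
      have "(\<lambda>n. 0) sums fun_of f z"
        using holomorphic_power_series[OF holomorphic_fun_of that, of f] by (simp add: 0)
      then show ?thesis
        using sums_0 sums_unique2 by blast
    qed
    then have "fun_of f = fun_of 0"
      using in_hardy2_fun_of[of f] by (auto simp: in_hardy2_def zero_hardy2.rep_eq fun_eq_iff)
    then show "f = 0"
      by (simp add: fun_of_inject)
  next
    assume "f = 0"
    then show "inner f f = 0"
      by (simp add: inner_hardy2_def zero_hardy2.rep_eq maclaurin_zero)
  qed
qed (simp_all add: norm_hardy2_def sgn_hardy2_def dist_hardy2_def
      uniformity_hardy2_def open_hardy2_def)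

end

lemma norm_hardy2_eq: "norm f = sqrt (\<Sum>n. (cmod (maclaurin (fun_of f) n))\<^sup>2)"
proof -
  have "Re (a * cnj a) = (cmod a)\<^sup>2" for a
    by (simp only: complex_norm_square[symmetric] Re_complex_of_real)
  then show ?thesis
    by (simp only: norm_hardy2_def inner_hardy2_def)
qed

instantiation hardy2 :: complex_normed_vector
begin

lift_definition scaleC_hardy2 :: "complex \<Rightarrow> hardy2 \<Rightarrow> hardy2" is "\<lambda>c f z. c * f z"
  by (rule in_hardy2_cmult)

instance
proof
  fix a b :: complex and f g :: hardy2 and r :: real
  show "a *\<^sub>C (f + g) = a *\<^sub>C f + a *\<^sub>C g"
    by transfer (simp add: algebra_simps)
  show "(a + b) *\<^sub>C f = a *\<^sub>C f + b *\<^sub>C f"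
    by transfer (simp add: algebra_simps)
  show "a *\<^sub>C b *\<^sub>C f = (a * b) *\<^sub>C f"
    by transfer (simp add: algebra_simps)
  show "complex_of_real r *\<^sub>C f = r *\<^sub>R f"
    by transfer simp
  show "norm (a *\<^sub>C f) = cmod a * norm f"
    by (simp add: norm_hardy2_eq scaleC_hardy2.rep_eq maclaurin_cmult holomorphic_fun_of
        norm_mult power_mult_distrib suminf_mult[OF summable_fun_of] real_sqrt_mult)
qed

end

text \<open>
  By Littlewood's subordination principle \<open>f \<circ> \<phi>\<close> lies in the Hardy space for every selfmap
  \<open>\<phi>\<close> of the disc, so that \<open>Abs_hardy2\<close> is applied to a member of the representing set.
\<close>

definition comp_op :: "(complex \<Rightarrow> complex) \<Rightarrow> hardy2 \<Rightarrow> hardy2" where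
  "comp_op \<phi> f = Abs_hardy2 (\<lambda>z. if z \<in> unit_disc then fun_of f (\<phi> z) else 0)"


section \<open>Selfmaps of the unit disc\<close>

text \<open>Only the values of \<open>\<phi>\<close> on the open unit disc matter in all notions below.\<close>

definition selfmap :: "(complex \<Rightarrow> complex) \<Rightarrow> bool" where
  "selfmap \<phi> \<longleftrightarrow> \<phi> holomorphic_on unit_disc \<and> \<phi> ` unit_disc \<subseteq> unit_disc"

definition cluster_set :: "(complex \<Rightarrow> complex) \<Rightarrow> complex \<Rightarrow> complex set" where
  "cluster_set \<phi> \<zeta> =
     {w. \<exists>z :: nat \<Rightarrow> complex. (\<forall>n. z n \<in> unit_disc) \<and> z \<longlonglongrightarrow> \<zeta> \<and> (\<lambda>n. \<phi> (z n)) \<longlonglongrightarrow> w}"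

definition boundary_preimage :: "(complex \<Rightarrow> complex) \<Rightarrow> complex \<Rightarrow> complex set" where
  "boundary_preimage \<phi> \<eta> = {\<zeta> \<in> sphere 0 1. \<eta> \<in> cluster_set \<phi> \<zeta>}"

text \<open>
  The proper subdiscs internally tangent to the unit circle at \<open>\<eta>\<close> are the discs of
  radius \<open>r < 1\<close> centred at \<open>(1 - r) \<eta>\<close>.
\<close>

definition essentially_linear_fractional :: "(complex \<Rightarrow> complex) \<Rightarrow> bool" where
  "essentially_linear_fractional \<phi> \<longleftrightarrow>
     selfmap \<phi> \<and>
     (\<exists>\<eta> \<in> sphere 0 1.
        (\<exists>r. 0 < r \<and> r < 1 \<and> \<phi> ` unit_disc \<subseteq> ball (complex_of_real (1 - r) * \<eta>) r) \<and>
        (\<exists>\<zeta>\<^sub>0. boundary_preimage \<phi> \<eta> = {\<zeta>\<^sub>0} \<and>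
           (\<exists>g. continuous_on (insert \<zeta>\<^sub>0 unit_disc) g \<and>
              (\<forall>z \<in> unit_disc. g z = (deriv ^^ 3) \<phi> z))))"

text \<open>The value at \<open>\<zeta>\<close> of the continuous extension of \<open>f\<close> from the disc to \<open>\<zeta>\<close>.\<close>

definition boundary_value :: "(complex \<Rightarrow> complex) \<Rightarrow> complex \<Rightarrow> complex" where
  "boundary_value f \<zeta> = Lim (at \<zeta> within unit_disc) f"

definition has_angular_limit :: "(complex \<Rightarrow> complex) \<Rightarrow> complex \<Rightarrow> complex \<Rightarrow> bool" where
  "has_angular_limit f \<omega> l \<longleftrightarrow>
     (\<forall>\<alpha>>1. (f \<longlongrightarrow> l) (at \<omega> within {z \<in> unit_disc. cmod (z - \<omega>) < \<alpha> * (1 - cmod z)}))"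

definition has_angular_derivative :: "(complex \<Rightarrow> complex) \<Rightarrow> complex \<Rightarrow> complex \<Rightarrow> bool" where
  "has_angular_derivative \<phi> \<omega> d \<longleftrightarrow>
     (\<exists>\<eta> \<in> sphere 0 1. has_angular_limit \<phi> \<omega> \<eta> \<and>
        has_angular_limit (\<lambda>z. (\<phi> z - \<eta>) / (z - \<omega>)) \<omega> d)"

definition denjoy_wolff_point :: "(complex \<Rightarrow> complex) \<Rightarrow> complex \<Rightarrow> bool" where
  "denjoy_wolff_point \<phi> \<omega> \<longleftrightarrow>
     \<omega> \<in> cball 0 1 \<and> (\<forall>z \<in> unit_disc. (\<lambda>n. (\<phi> ^^ n) z) \<longlonglongrightarrow> \<omega>)"

definition hyperbolic_type :: "(complex \<Rightarrow> complex) \<Rightarrow> bool" where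
  "hyperbolic_type \<phi> \<longleftrightarrow>
     (\<exists>\<omega> \<in> sphere 0 1. denjoy_wolff_point \<phi> \<omega> \<and>
        (\<exists>d::real. has_angular_derivative \<phi> \<omega> (complex_of_real d) \<and> d < 1))"

end

theory Submission
  imports Defs
begin

text \<open>
  In the half-plane coordinate \<open>cayley z = (1 + z) / (1 - z)\<close> the map \<open>\<phi>\<close> is division by
  \<open>a = \<phi>'(1)\<close> up to a bounded error near infinity, so \<open>a\<^sup>n cayley (\<phi>\<^sup>n z)\<close> converges to a
  function \<open>\<sigma>\<close> of positive real part with \<open>\<sigma> \<circ> \<phi> = \<sigma> / a\<close>; the tangent subdisc bounds \<open>Re \<sigma>\<close> away
  from \<open>0\<close>. Hence \<open>\<sigma>\<^sup>s\<close> lies in \<open>H\<^sup>2\<close> whenever \<open>Re s < 1/2\<close> and is an eigenvector for \<open>a\<^sup>-\<^sup>s\<close>, so every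
  \<open>\<mu>\<close> with \<open>0 < \<bar>\<mu>\<bar> < a\<^sup>-\<^sup>1\<^sup>/\<^sup>2\<close> has an infinite-dimensional eigenspace, the exponents being determined
  only modulo \<open>2\<pi>i / ln a\<close>. The nullity of a Fredholm operator cannot jump up under a small
  perturbation, which puts the whole closed disc into the essential spectrum. Conversely
  Littlewood's bound \<open>\<parallel>C\<^sub>\<phi>\<^sup>n\<parallel>\<^sup>2 \<le> (1 + \<bar>\<phi>\<^sup>n(0)\<bar>) / (1 - \<bar>\<phi>\<^sup>n(0)\<bar>) = O(a\<^sup>-\<^sup>n)\<close> bounds the spectral radius.
\<close>

section \<open>Open mapping, Fredholm perturbation and Neumann series\<close>

text \<open>The Hardy norm is given by Maclaurin coefficients, so boundary values never enter: a
  harmonic majorant \<open>Re (G z)\<close> of the squared modulus bounds the squared norm by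
  \<open>Re (G 0)\<close>. This one device yields both Littlewood's bound and the membership of the
  eigenfunctions. The exponent 1/2 has two matching sources. Up to a bounded factor the squared
  modulus of \<sigma>^s is |\<sigma>|^(2 Re s), and nonnegative powers of a half-plane variable have
  real part comparable to their modulus for exponents below 1; on the other side O(a^(-n)) bounds a
  squared norm. The lower bound on Re \<sigma> serves Re s < 0, that is |\<mu>| < 1, where
  \<sigma>^s grows as \<sigma> approaches 0. A bounded error in the half-plane coordinate is what a
  quadratic Taylor remainder at 1 amounts to, since the coordinate has a simple pole there; the
  increments of the rescaled iterates are then O(a^n). Eigenfunctions exist for the punctured open
  disc only, and the nullity argument supplies its centre and its bounding circle at once.\<close>

text \<open>Baire category in the complete space \<open>range T\<close>: the closures
  \<open>A n\<close> cover it, so one of them contains a relative ball about some \<open>y0\<close>.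
  A small \<open>y\<close> is the difference of \<open>y0 + y\<close> and \<open>y0\<close>, hence
  approximable by images of vectors of norm below \<open>2 * real n\<close>; scaling makes the bound
  linear.\<close>

lemma open_mapping_half:
  fixes T :: "'a::real_normed_vector \<Rightarrow> 'b::banach"
  assumes T: "bounded_linear T" and cl: "closed (range T)"
  obtains K where "K > 0"
    "\<And>y. y \<in> range T \<Longrightarrow> \<exists>x. norm x \<le> K * norm y \<and> norm (y - T x) \<le> norm y / 2"
proof -
  interpret bounded_linear T by (rule T)
  define R where "R = range T"
  define X where "X = top_of_set R"
  define A where "A n = closure (T ` ball 0 (real n))" for n
  have AR: "A n \<subseteq> R" for n
    unfolding A_def R_def using cl by (intro closure_minimal) auto
  have "R \<subseteq> (\<Union>n. A n)"
  proof
    fix y assume "y \<in> R"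
    then obtain x where x: "y = T x" by (auto simp: R_def)
    obtain n where "norm x < real n" using reals_Archimedean2 by blast
    then have "y \<in> T ` ball 0 (real n)" unfolding x by (intro imageI) simp
    then have "y \<in> A n" unfolding A_def by (rule subsetD[OF closure_subset])
    then show "y \<in> (\<Union>n. A n)" by blast
  qed
  then have UN: "\<Union>(range A) = R" using AR by blast
  have "completely_metrizable_space X"
    unfolding X_def using cl
    by (intro completely_metrizable_space_closedin completely_metrizable_space_euclidean)
      (auto simp: R_def)
  moreover have "X interior_of R = R"
    using interior_of_topspace[of X] by (simp add: X_def)
  moreover have "R \<noteq> {}" by (simp add: R_def)
  moreover have "closedin X (A n)" for n
    using AR[of n] cl by (simp add: X_def A_def R_def closedin_closed_eq)
  ultimately have "\<exists>n. X interior_of (A n) \<noteq> {}"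
    using Baire_category_alt[of X "range A"] UN by auto
  then obtain n where n: "X interior_of (A n) \<noteq> {}" by blast
  then obtain y0 where y0: "y0 \<in> X interior_of (A n)" by blast
  then obtain U where U: "open U" "y0 \<in> U" "R \<inter> U \<subseteq> A n" "y0 \<in> R"
    by (auto simp: interior_of_def X_def openin_open)
  then obtain e where e: "e > 0" "ball y0 e \<subseteq> U"
    using open_contains_ball by metis
  have near: "\<exists>x. norm x < 2 * real n \<and> norm (y - T x) < d"
    if y: "y \<in> R" "norm y < e" and d: "d > 0" for y d
  proof -
    have d2: "d / 2 > 0" using d by simp
    have approx: "\<exists>x. norm x < real n \<and> dist (T x) v < d / 2" if "v \<in> A n" for v
      using that d2 unfolding A_def closure_approachable by fastforce
    have "y0 + y \<in> A n"
    proof -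
      obtain a b where "y0 = T a" "y = T b" using y(1) U(4) unfolding R_def by blast
      then have "y0 + y = T (a + b)" by (simp add: add)
      then have "y0 + y \<in> R" by (simp add: R_def)
      moreover have "y0 + y \<in> ball y0 e" using y by (simp add: dist_norm)
      ultimately show ?thesis using e U by blast
    qed
    then obtain x1 where x1: "norm x1 < real n" "dist (T x1) (y0 + y) < d / 2"
      using approx by blast
    have "y0 \<in> A n" using U by blast
    then obtain x2 where x2: "norm x2 < real n" "dist (T x2) y0 < d / 2"
      using approx by blast
    have "norm (x1 - x2) < 2 * real n"
      using norm_triangle_ineq4[of x1 x2] x1 x2 by linarith
    moreover have "y - T (x1 - x2) = ((y0 + y) - T x1) - (y0 - T x2)"
      by (simp add: diff)
    then have "norm (y - T (x1 - x2)) \<le> dist (T x1) (y0 + y) + dist (T x2) y0"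
      using norm_triangle_ineq4[of "(y0 + y) - T x1" "y0 - T x2"]
      by (simp only: dist_norm norm_minus_commute)
    then have "norm (y - T (x1 - x2)) < d" using x1 x2 by linarith
    ultimately show ?thesis by blast
  qed
  have npos: "real n > 0"
  proof -
    have "0 \<in> R" using rangeI[of T 0] by (simp add: R_def zero)
    then obtain x :: 'a where "norm x < 2 * real n" using near[of 0 1] e by auto
    then show ?thesis by (smt (verit) norm_ge_zero)
  qed
  show thesis
  proof
    show "4 * real n / e > 0" using npos e by simp
    fix y assume y: "y \<in> range T"
    show "\<exists>x. norm x \<le> 4 * real n / e * norm y \<and> norm (y - T x) \<le> norm y / 2"
    proof (cases "y = 0")
      case True
      then show ?thesis by (intro exI[of _ 0]) (simp add: zero)
    next
      case False
      \<comment> \<open>The scaling brings \<open>y\<close> to norm \<open>e / 2\<close>, inside the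
        ball of radius \<open>e\<close>; dividing \<open>2 * real n\<close> by \<open>c\<close>
        produces the constant \<open>4 * real n / e\<close>.\<close>
      define c where "c = e / (2 * norm y)"
      have c: "c > 0" using e False by (simp add: c_def)
      have "c *\<^sub>R y \<in> R" using y unfolding R_def by (metis rangeE range_eqI scaleR)
      moreover have "norm (c *\<^sub>R y) < e" using c e False by (simp add: c_def)
      ultimately obtain x where x: "norm x < 2 * real n" "norm (c *\<^sub>R y - T x) < c * norm y / 2"
        using near[of "c *\<^sub>R y" "c * norm y / 2"] c False by auto
      have "norm (x /\<^sub>R c) \<le> 4 * real n / e * norm y"
        using x(1) c e False by (simp add: c_def field_simps)
      moreover have "y - T (x /\<^sub>R c) = (c *\<^sub>R y - T x) /\<^sub>R c"
        using c by (simp add: scaleR scaleR_diff_right)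
      then have "norm (y - T (x /\<^sub>R c)) = norm (c *\<^sub>R y - T x) / c"
        using c by (simp only: norm_scaleR) (simp add: divide_inverse mult.commute)
      then have "norm (y - T (x /\<^sub>R c)) \<le> norm y / 2"
        using x(2) c by (simp only: pos_divide_le_eq) (simp add: mult.commute)
      ultimately show ?thesis by blast
    qed
  qed
qed

text \<open>The residual \<open>r k\<close> is corrected by the approximate preimage
  \<open>g (r k)\<close> and at least halves each time. Completeness of the domain sums the
  corrections, telescoping identifies the image of the sum, and the geometric series turns
  \<open>K\<close> into \<open>2 * K\<close>.\<close>

lemma open_mapping_closed_range:
  fixes T :: "'a::banach \<Rightarrow> 'b::banach"
  assumes T: "bounded_linear T" and cl: "closed (range T)"
  obtains C where "C > 0" "\<And>y. y \<in> range T \<Longrightarrow> \<exists>x. T x = y \<and> norm x \<le> C * norm y"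
proof -
  interpret bounded_linear T by (rule T)
  obtain K where K: "K > 0"
    "\<And>y. y \<in> range T \<Longrightarrow> \<exists>x. norm x \<le> K * norm y \<and> norm (y - T x) \<le> norm y / 2"
    using open_mapping_half[OF assms] by blast
  then obtain g where g: "\<And>y. y \<in> range T \<Longrightarrow> norm (g y) \<le> K * norm y"
    "\<And>y. y \<in> range T \<Longrightarrow> norm (y - T (g y)) \<le> norm y / 2"
    by metis
  show thesis
  proof
    show "2 * K > 0" using K by simp
    fix y assume y: "y \<in> range T"
    define r where "r k = ((\<lambda>y. y - T (g y)) ^^ k) y" for k
    have r_Suc: "r (Suc k) = r k - T (g (r k))" for k by (simp add: r_def)
    have rR: "r k \<in> range T" for k
    proof (induction k)
      case 0
      show ?case using y by (simp add: r_def)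
    next
      case (Suc k)
      then show ?case unfolding r_Suc by (metis diff rangeE range_eqI)
    qed
    have rn: "norm (r k) \<le> norm y * (1/2) ^ k" for k
    proof (induction k)
      case 0
      show ?case by (simp add: r_def)
    next
      case (Suc k)
      show ?case using g(2)[OF rR[of k]] Suc unfolding r_Suc by simp
    qed
    have gn: "norm (g (r k)) \<le> K * norm y * (1/2) ^ k" for k
      using g(1)[OF rR[of k]] mult_left_mono[OF rn[of k], of K] K(1)
      unfolding mult.assoc by (meson less_imp_le order_trans)
    have sg: "summable (\<lambda>k. K * norm y * (1/2::real) ^ k)"
      by (intro summable_mult summable_geometric) simp
    have sng: "summable (\<lambda>k. norm (g (r k)))"
      by (rule summable_comparison_test[OF _ sg]) (use gn in auto)
    then have sm: "summable (\<lambda>k. g (r k))" by (rule summable_norm_cancel)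
    define x where "x = (\<Sum>k. g (r k))"
    have "norm x \<le> (\<Sum>k. norm (g (r k)))"
      unfolding x_def using sng by (rule summable_norm)
    also have "\<dots> \<le> (\<Sum>k. K * norm y * (1/2) ^ k)"
      by (rule suminf_le[OF gn sng sg])
    also have "\<dots> = 2 * K * norm y"
      using suminf_geometric[of "1/2::real"] by (subst suminf_mult) (auto intro: summable_geometric)
    finally have "norm x \<le> 2 * K * norm y" .
    moreover have "T x = y"
    proof -
      have "r \<longlonglongrightarrow> 0"
      proof (rule Lim_null_comparison)
        show "\<forall>\<^sub>F k in sequentially. norm (r k) \<le> norm y * (1/2) ^ k" using rn by simp
        show "(\<lambda>k. norm y * (1/2::real) ^ k) \<longlonglongrightarrow> 0"
          by (intro tendsto_mult_right_zero LIMSEQ_power_zero) simp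
      qed
      then have "(\<lambda>k. r k - r (Suc k)) sums (r 0 - 0)" by (rule telescope_sums')
      then have "(\<lambda>k. T (g (r k))) sums y" by (simp add: r_Suc) (simp add: r_def)
      moreover have "(\<lambda>k. T (g (r k))) sums T x"
        unfolding x_def by (rule sums[OF summable_sums[OF sm]])
      ultimately show ?thesis by (rule sums_unique2[symmetric])
    qed
    ultimately show "\<exists>x. T x = y \<and> norm x \<le> 2 * K * norm y" by blast
  qed
qed

text \<open>One condition \<open>inner x a = 0\<close> is the kernel of one functional, so adjoining
  a single vector \<open>v\<close> off that kernel recovers the larger space; finitely many
  conditions thus cannot make an infinite-dimensional space finite-dimensional.\<close>

lemma subspace_Int_orthogonal_not_finite_dim:
  fixes V :: "'a::real_inner set"
  assumes V: "subspace V" "\<And>B. finite B \<Longrightarrow> \<not> V \<subseteq> span B" and A: "finite A"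
  shows "subspace {x \<in> V. \<forall>a\<in>A. inner x a = 0} \<and>
    (\<forall>B. finite B \<longrightarrow> \<not> {x \<in> V. \<forall>a\<in>A. inner x a = 0} \<subseteq> span B)"
  using A
proof (induction A)
  case empty
  show ?case using V by simp
next
  case (insert a A)
  define W where "W = {x \<in> V. \<forall>a\<in>A. inner x a = 0}"
  have W: "subspace W" "\<And>B. finite B \<Longrightarrow> \<not> W \<subseteq> span B"
    using insert.IH by (auto simp: W_def)
  have eq: "{x \<in> V. \<forall>b\<in>insert a A. inner x b = 0} = {x \<in> W. inner x a = 0}"
    by (auto simp: W_def)
  have "subspace {x \<in> W. inner x a = 0}"
    using W(1) by (auto simp: subspace_def inner_add_left)
  moreover have "\<not> {x \<in> W. inner x a = 0} \<subseteq> span B" if B: "finite B" for B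
  proof
    assume sub: "{x \<in> W. inner x a = 0} \<subseteq> span B"
    obtain v where v: "v \<in> W" "inner v a \<noteq> 0"
      using W(2)[OF B] sub by blast
    have "W \<subseteq> span (insert v B)"
    proof
      fix x assume x: "x \<in> W"
      define c where "c = inner x a / inner v a"
      have "x - c *\<^sub>R v \<in> W"
        using x v W(1) by (simp add: subspace_diff subspace_scale)
      moreover have "inner (x - c *\<^sub>R v) a = 0"
        using v by (simp add: c_def inner_diff_left)
      ultimately have "x - c *\<^sub>R v \<in> span B" using sub by blast
      then show "x \<in> span (insert v B)" using span_breakdown_eq by blast
    qed
    then show False using W(2)[of "insert v B"] B by simp
  qed
  ultimately show ?case unfolding eq by blast
qed

lemma scaleC_ii_decomp:
  fixes x :: "'a::complex_normed_vector"
  shows "c *\<^sub>C x = Re c *\<^sub>R x + Im c *\<^sub>R (\<i> *\<^sub>C x)"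
proof -
  have "c *\<^sub>C x = (complex_of_real (Re c) + complex_of_real (Im c) * \<i>) *\<^sub>C x"
    by (simp add: complex_eq mult.commute)
  also have "\<dots> = Re c *\<^sub>R x + Im c *\<^sub>R (\<i> *\<^sub>C x)"
    by (simp only: scaleC_add_left scaleC_scaleC[symmetric] scaleC_of_real)
  finally show ?thesis .
qed

text \<open>Orthogonality refers to the real inner product, while the Fredholm property speaks of
  complex spans. Adjoining the multiples by \<i> keeps the generating set finite, which is all that
  the passage to real spans requires.\<close>

lemma cspan_subset_real_span:
  fixes B :: "'a::complex_normed_vector set"
  shows "cspan B \<subseteq> span (B \<union> (\<lambda>x. \<i> *\<^sub>C x) ` B)"
proof
  fix x assume "x \<in> cspan B"
  then obtain F u where F: "finite F" "F \<subseteq> B" "x = (\<Sum>b\<in>F. u b *\<^sub>C b)"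
    unfolding complex_vector.span_explicit by blast
  show "x \<in> span (B \<union> (\<lambda>x. \<i> *\<^sub>C x) ` B)"
    unfolding F(3) scaleC_ii_decomp[of "u _"] using F(2)
    by (intro span_sum span_add span_scale span_base) auto
qed

lemma real_span_subset_cspan:
  fixes B :: "'a::complex_normed_vector set"
  shows "span B \<subseteq> cspan B"
proof (rule span_minimal)
  show "B \<subseteq> cspan B" by (rule complex_vector.span_superset)
  show "subspace (cspan B)"
    unfolding subspace_def
    by (auto simp: complex_vector.span_zero complex_vector.span_add scaleC_of_real[symmetric]
        complex_vector.span_scale)
qed

text \<open>
  Off the kernel of a Fredholm operator \<open>T - \<mu>\<close> the open mapping theorem bounds it below by some
  \<open>1/C\<close>, so an eigenvector of \<open>T\<close> for a nearby \<open>\<nu>\<close> cannot be orthogonal to that kernel.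
\<close>
lemma Fredholm_imp_nearby_kernels_finite_dim:
  fixes T :: "'a::{complex_normed_vector,real_inner,banach} \<Rightarrow> 'a"
  assumes "Fredholm (op_minus T \<mu>)"
  obtains e where "e > 0"
    "\<And>\<nu>. cmod (\<nu> - \<mu>) < e \<Longrightarrow> \<exists>B. finite B \<and> {x. T x = \<nu> *\<^sub>C x} \<subseteq> cspan B"
proof -
  let ?S = "op_minus T \<mu>"
  have bl: "bounded_linear ?S" and cl: "closed (range ?S)"
    using assms by (auto simp: Fredholm_def bounded_clinear_def)
  interpret S: bounded_linear ?S by (rule bl)
  have cS: "?S (c *\<^sub>C x) = c *\<^sub>C ?S x" for c x
    using assms by (auto simp: Fredholm_def bounded_clinear_def)
  obtain B0 where B0: "finite B0" "{x. ?S x = 0} \<subseteq> cspan B0"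
    using assms by (auto simp: Fredholm_def)
  define A where "A = B0 \<union> (\<lambda>x. \<i> *\<^sub>C x) ` B0"
  have A: "finite A" "{x. ?S x = 0} \<subseteq> span A"
    using B0 cspan_subset_real_span[of B0] by (auto simp: A_def)
  obtain C where C: "C > 0"
    "\<And>y. y \<in> range ?S \<Longrightarrow> \<exists>x. ?S x = y \<and> norm x \<le> C * norm y"
    using open_mapping_closed_range[OF bl cl] by blast
  show thesis
  proof
    show "1 / C > 0" using C by simp
    fix \<nu> assume \<nu>: "cmod (\<nu> - \<mu>) < 1 / C"
    define V where "V = {x. T x = \<nu> *\<^sub>C x}"
    have V: "x \<in> V \<longleftrightarrow> ?S x = (\<nu> - \<mu>) *\<^sub>C x" for x
      by (simp add: V_def op_minus_def complex_vector.scale_left_diff_distrib)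
    have subV: "subspace V"
    proof (rule subspaceI)
      show "0 \<in> V" by (simp add: V S.zero)
      show "x + y \<in> V" if "x \<in> V" "y \<in> V" for x y
        using that by (simp add: V S.add scaleC_add_right)
      show "c *\<^sub>R x \<in> V" if "x \<in> V" for c x
        using that unfolding V scaleC_of_real[symmetric] cS
        by (simp only: complex_vector.scale_left_commute)
    qed
    \<comment> \<open>Being orthogonal to the kernel, \<open>x\<close> is the shortest preimage of
      \<open>?S x\<close>. Compared with the controlled preimage \<open>x'\<close> this bounds the
      norm of \<open>x\<close> by C |\<nu> - \<mu>| times itself, and that factor is below
      1.\<close>
    have orth: "x = 0" if x: "x \<in> V" "\<forall>a\<in>A. inner x a = 0" for x
    proof (rule ccontr)
      assume x0: "x \<noteq> 0"
      obtain x' where x': "?S x' = ?S x" "norm x' \<le> C * norm (?S x)"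
        using C(2)[of "?S x"] by blast
      have "?S (x' - x) = 0" using x' by (simp add: S.diff)
      then have "x' - x \<in> span A" using A by blast
      then have "orthogonal x (x' - x)"
        by (rule orthogonal_to_span) (use x in \<open>simp add: orthogonal_def\<close>)
      then have "inner x x' = inner x x"
        by (simp add: orthogonal_def inner_diff_right)
      then have "norm x * norm x \<le> norm x * norm x'"
        using Cauchy_Schwarz_ineq2[of x x'] by (simp add: power2_norm_eq_inner[symmetric] power2_eq_square)
      then have "norm x \<le> norm x'" using x0 by simp
      also have "\<dots> \<le> C * (cmod (\<nu> - \<mu>) * norm x)"
        using x'(2) x(1) V by (simp add: norm_scaleC)
      also have "\<dots> = (C * cmod (\<nu> - \<mu>)) * norm x" by simp
      also have "\<dots> < 1 * norm x"
        using \<nu> C(1) x0 by (intro mult_strict_right_mono) (auto simp: field_simps)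
      finally show False by simp
    qed
    have "\<exists>B. finite B \<and> V \<subseteq> span B"
    proof (rule ccontr)
      assume "\<not> ?thesis"
      then have "\<not> {x \<in> V. \<forall>a\<in>A. inner x a = 0} \<subseteq> span {}"
        using subspace_Int_orthogonal_not_finite_dim[OF subV _ A(1)] by blast
      then show False using orth by auto
    qed
    then show "\<exists>B. finite B \<and> {x. T x = \<nu> *\<^sub>C x} \<subseteq> cspan B"
      using real_span_subset_cspan V_def by blast
  qed
qed

section \<open>Resolvents by Neumann series\<close>

lemma bounded_linear_scaleC: "bounded_linear (\<lambda>x::'a::complex_normed_vector. c *\<^sub>C x)"
proof (rule bounded_linear_intro[where K = "cmod c"])
  fix x y :: 'a and r :: real
  show "c *\<^sub>C (x + y) = c *\<^sub>C x + c *\<^sub>C y" by (rule scaleC_add_right)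
  show "c *\<^sub>C r *\<^sub>R x = r *\<^sub>R c *\<^sub>C x"
    unfolding scaleC_of_real[symmetric] by (rule complex_vector.scale_left_commute)
  show "norm (c *\<^sub>C x) \<le> norm x * cmod c" by (simp add: norm_scaleC)
qed

lemma bounded_clinear_op_minus:
  fixes T :: "'a::complex_normed_vector \<Rightarrow> 'a"
  assumes "bounded_clinear T"
  shows "bounded_clinear (op_minus T \<mu>)"
proof -
  have "bounded_linear (\<lambda>x::'a. \<mu> *\<^sub>C x)"
    by (rule bounded_linear_scaleC)
  then show ?thesis
    using assms unfolding bounded_clinear_def op_minus_def
    by (auto intro: bounded_linear_sub simp: complex_vector.scale_right_diff_distrib
        complex_vector.scale_left_commute)
qed

lemma op_invertible_imp_Fredholm:
  assumes "op_invertible T"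
  shows "Fredholm T"
proof -
  obtain S where S: "bounded_clinear T" "S \<circ> T = id" "T \<circ> S = id"
    using assms by (auto simp: op_invertible_def)
  have ST: "S (T x) = x" and TS: "T (S x) = x" for x
    using S by (auto dest: fun_cong)
  have "T 0 = 0"
    using S(1) by (simp add: bounded_clinear_def bounded_linear.linear linear_0)
  then have "{x. T x = 0} = {0}" using ST by auto (metis ST)
  moreover have "range T = UNIV" using TS by (metis surjI)
  moreover have "y - T (S y) \<in> cspan {}" for y using TS by simp
  ultimately show ?thesis
    unfolding Fredholm_def using S(1)
    by (metis (no_types, lifting) closed_UNIV complex_vector.span_empty finite.emptyI subset_refl)
qed

text \<open>The candidate inverse is minus the sum of \<open>T ^^ n\<close> over \<mu>^(n+1), summed
  pointwise. Bounding the growth of the powers, and not \<open>T\<close> alone, is what makes the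
  result as sharp as the spectral radius.\<close>

lemma Neumann_invertible:
  fixes T :: "'a::{complex_normed_vector,banach} \<Rightarrow> 'a"
  assumes T: "bounded_clinear T"
    and bound: "\<And>n x. norm ((T ^^ n) x) \<le> C * r ^ n * norm x"
    and r: "0 < r" "r < cmod \<mu>"
  shows "op_invertible (op_minus T \<mu>)"
proof -
  interpret T: bounded_linear T using T by (simp add: bounded_clinear_def)
  have Tc: "T (c *\<^sub>C x) = c *\<^sub>C T x" for c x using T by (simp add: bounded_clinear_def)
  have \<mu>: "\<mu> \<noteq> 0" using r by auto
  note blc = bounded_linear_scaleC
  define t where "t n x = (- (inverse \<mu> ^ Suc n)) *\<^sub>C (T ^^ n) x" for n x
  have Tn_add: "(T ^^ n) (x + y) = (T ^^ n) x + (T ^^ n) y" for n x y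
    by (induction n) (auto simp: T.add)
  have Tn_scale: "(T ^^ n) (c *\<^sub>C x) = c *\<^sub>C (T ^^ n) x" for n c x
    by (induction n) (auto simp: Tc)
  have q: "r / cmod \<mu> < 1" "0 \<le> r / cmod \<mu>" using r \<mu> by auto
  have tn: "norm (t n x) \<le> C / cmod \<mu> * norm x * (r / cmod \<mu>) ^ n" for n x
  proof -
    have "norm (t n x) = norm ((T ^^ n) x) / cmod \<mu> ^ Suc n"
      by (simp add: t_def norm_scaleC norm_mult norm_power norm_inverse divide_inverse power_inverse)
    also have "\<dots> \<le> (C * r ^ n * norm x) / cmod \<mu> ^ Suc n"
      by (rule divide_right_mono[OF bound]) simp
    finally show ?thesis by (simp add: power_divide field_simps)
  qed
  have sg: "summable (\<lambda>n. C / cmod \<mu> * norm x * (r / cmod \<mu>) ^ n)" for x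
    using q by (intro summable_mult summable_geometric) auto
  have snt: "summable (\<lambda>n. norm (t n x))" for x
    by (rule summable_comparison_test[OF _ sg[of x]]) (use tn in auto)
  then have st: "summable (\<lambda>n. t n x)" for x by (rule summable_norm_cancel)
  define S where "S x = (\<Sum>n. t n x)" for x
  have S_add: "S (x + y) = S x + S y" for x y
    unfolding S_def suminf_add[OF st st]
    by (simp add: t_def Tn_add scaleC_add_right del: power_Suc)
  have S_scale: "S (c *\<^sub>C x) = c *\<^sub>C S x" for c x
    unfolding S_def bounded_linear.suminf[OF blc st]
    by (simp add: t_def Tn_scale mult.commute del: power_Suc)
  have S_norm: "norm (S x) \<le> norm x * (C / cmod \<mu> * (1 / (1 - r / cmod \<mu>)))" for x
  proof -
    have "norm (S x) \<le> (\<Sum>n. norm (t n x))"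
      unfolding S_def by (rule summable_norm[OF snt])
    also have "\<dots> \<le> (\<Sum>n. C / cmod \<mu> * norm x * (r / cmod \<mu>) ^ n)"
      by (rule suminf_le[OF tn snt sg])
    also have "\<dots> = C / cmod \<mu> * norm x * (1 / (1 - r / cmod \<mu>))"
      using q by (subst suminf_mult) (auto simp: suminf_geometric intro: summable_geometric)
    finally show ?thesis by (simp add: mult_ac)
  qed
  have "bounded_linear S"
    by (rule bounded_linear_intro[OF _ _ S_norm]) (simp_all add: S_add S_scale scaleC_of_real[symmetric])
  then have bS: "bounded_clinear S" using S_scale by (simp add: bounded_clinear_def)
  have step: "T (t n x) = \<mu> *\<^sub>C t (Suc n) x" for n x
  proof -
    have "\<mu> * - (inverse \<mu> ^ Suc (Suc n)) = - (inverse \<mu> ^ Suc n)"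
      using \<mu> by simp
    then show ?thesis
      unfolding t_def Tc scaleC_scaleC by (simp only: funpow.simps o_apply)
  qed
  have t0: "\<mu> *\<^sub>C t 0 x = - x" for x
    using \<mu> by (simp add: t_def scaleC_scaleC scaleC_one)
  have TSx: "T (S x) - \<mu> *\<^sub>C S x = x" for x
  proof -
    have "T (S x) = (\<Sum>n. \<mu> *\<^sub>C t (Suc n) x)"
      unfolding S_def T.suminf[OF st] by (simp add: step)
    also have "\<dots> = \<mu> *\<^sub>C (\<Sum>n. t (Suc n) x)"
      by (rule bounded_linear.suminf[OF blc, symmetric])
        (rule summable_Suc_iff[THEN iffD2, OF st])
    also have "\<dots> = \<mu> *\<^sub>C (S x - t 0 x)"
      unfolding S_def by (simp add: suminf_split_head[OF st])
    finally show ?thesis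
      by (simp add: complex_vector.scale_right_diff_distrib t0)
  qed
  have comm: "S (T x) = T (S x)" for x
    unfolding S_def T.suminf[OF st]
    by (simp only: t_def Tc funpow_swap1)
  have "S \<circ> op_minus T \<mu> = id"
  proof
    fix x
    have "S (T x - \<mu> *\<^sub>C x) = S (T x) - \<mu> *\<^sub>C S x"
      using S_add[of "T x" "(- \<mu>) *\<^sub>C x"] S_scale[of "- \<mu>" x] by simp
    then show "(S \<circ> op_minus T \<mu>) x = id x"
      by (simp add: op_minus_def comm TSx)
  qed
  moreover have "op_minus T \<mu> \<circ> S = id"
    by (auto simp: op_minus_def TSx)
  ultimately show ?thesis
    unfolding op_invertible_def using bounded_clinear_op_minus[OF T] bS by blast
qed


section \<open>Harmonic majorants and Littlewood subordination\<close>

text \<open>Cauchy's coefficient formula in the circle parameter: the velocity of the path is 2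
  \<pi> \<i> times the point itself, which cancels one factor and leaves the exponent
  \<open>n\<close> in place of \<open>Suc n\<close>.\<close>

lemma has_integral_circle_maclaurin:
  assumes f: "f holomorphic_on unit_disc" and r: "0 < r" "r < 1"
  shows "((\<lambda>t. f (circlepath 0 r t) / circlepath 0 r t ^ n) has_integral maclaurin f n) {0..1}"
proof -
  have "f holomorphic_on cball 0 r"
    using f r by (rule_tac holomorphic_on_subset) auto
  then have "((\<lambda>u. f u / (u - 0) ^ Suc n) has_contour_integral
      (2 * pi * \<i>) / fact n * (deriv ^^ n) f 0) (circlepath 0 r)"
    using r by (intro Cauchy_has_contour_integral_higher_derivative_circlepath)
      (auto intro: holomorphic_on_imp_continuous_on holomorphic_on_subset)
  then have "((\<lambda>t. f (circlepath 0 r t) / circlepath 0 r t ^ Suc n *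
      (2 * pi * \<i> * r * exp (2 * of_real pi * \<i> * t))) has_integral
      (2 * pi * \<i>) / fact n * (deriv ^^ n) f 0) {0..1}"
    by (simp add: has_contour_integral vector_derivative_circlepath)
  from has_integral_mult_right[OF this, of "1 / (2 * pi * \<i>)"]
  have "((\<lambda>t. 1 / (2 * pi * \<i>) * (f (circlepath 0 r t) / circlepath 0 r t ^ Suc n *
      (2 * pi * \<i> * r * exp (2 * of_real pi * \<i> * t)))) has_integral maclaurin f n) {0..1}"
    by (simp add: maclaurin_def)
  then show ?thesis
    using r by (subst has_integral_cong) (auto simp: circlepath)
qed

lemma maclaurin_power: "maclaurin (\<lambda>z. z ^ m) n = (if n = m then 1 else 0)"
  using higher_deriv_power[of n 0 m 0]
  by (auto simp: maclaurin_def not_less pochhammer_fact[symmetric] pochhammer_0_left le_Suc_eq Suc_diff_le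
      split: if_splits)

text \<open>
  Bessel's inequality: integrate \<open>|F - P|\<^sup>2 \<le> Re (G - 2 F cnj P + P cnj P)\<close> over the circle of
  radius \<open>r\<close>, where \<open>P\<close> is the Taylor polynomial of \<open>F\<close> and \<open>cnj z = r\<^sup>2 / z\<close>.
\<close>
lemma sum_maclaurin_le_majorant_scaled:
  assumes F: "F holomorphic_on unit_disc" and G: "G holomorphic_on unit_disc"
    and le: "\<And>z. z \<in> unit_disc \<Longrightarrow> (cmod (F z))\<^sup>2 \<le> Re (G z)"
    and r: "0 < r" "r < 1"
  shows "(\<Sum>n<N. (cmod (maclaurin F n))\<^sup>2 * r ^ (2 * n)) \<le> Re (G 0)"
proof -
  define a where "a = maclaurin F"
  define c where "c = circlepath 0 r"
  define A where "A = (\<Sum>n<N. cnj (a n) * of_real (r ^ (2 * n)) * a n)"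
  define H where "H t = G (c t) - 2 * (\<Sum>n<N. cnj (a n) * of_real (r ^ (2 * n)) * (F (c t) / c t ^ n))
     + (\<Sum>n<N. cnj (a n) * of_real (r ^ (2 * n)) * (\<Sum>m<N. a m * (c t ^ m / c t ^ n)))" for t
  have IG: "((\<lambda>t. G (c t)) has_integral G 0) {0..1}"
    using has_integral_circle_maclaurin[OF G r, of 0] by (simp add: c_def maclaurin_def)
  have IF: "((\<lambda>t. F (c t) / c t ^ n) has_integral a n) {0..1}" for n
    unfolding c_def a_def by (rule has_integral_circle_maclaurin[OF F r])
  have IP: "((\<lambda>t. c t ^ m / c t ^ n) has_integral (if n = m then 1 else 0)) {0..1}" for m n
    unfolding c_def maclaurin_power[symmetric, of n m]
    by (rule has_integral_circle_maclaurin[OF _ r]) (intro holomorphic_intros)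
  have "(H has_integral (G 0 - 2 * A +
      (\<Sum>n<N. cnj (a n) * of_real (r ^ (2 * n)) * (\<Sum>m<N. a m * (if n = m then 1 else 0))))) {0..1}"
    unfolding H_def A_def
    by (intro has_integral_add has_integral_diff has_integral_sum has_integral_mult_right IG IF IP) auto
  also have "(\<Sum>n<N. cnj (a n) * of_real (r ^ (2 * n)) * (\<Sum>m<N. a m * (if n = m then 1 else 0))) = A"
    unfolding A_def by (intro sum.cong refl) (simp add: if_distrib sum.delta' cong: if_cong)
  finally have "((\<lambda>t. Re (H t)) has_integral Re (G 0 - 2 * A + A)) {0..1}"
    by (rule has_integral_Re)
  moreover have "0 \<le> Re (H t)" for t
  proof -
    define P where "P = (\<Sum>n<N. a n * c t ^ n)"
    have ct: "cmod (c t) = r" "c t \<noteq> 0"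
      using r by (auto simp: c_def circlepath norm_mult)
    have cn: "of_real (r ^ (2 * n)) / c t ^ n = cnj (c t) ^ n" for n
    proof -
      have "c t * cnj (c t) = of_real (r\<^sup>2)"
        using ct by (simp add: complex_norm_square[symmetric] del: of_real_power)
      then have "(c t * cnj (c t)) ^ n = of_real (r ^ (2 * n))"
        by (simp add: power_mult)
      then show ?thesis using ct by (simp add: power_mult_distrib field_simps)
    qed
    have "(\<Sum>n<N. cnj (a n) * of_real (r ^ (2 * n)) * (F (c t) / c t ^ n)) = F (c t) * cnj P"
      unfolding P_def cnj_sum sum_distrib_left
      by (intro sum.cong refl) (simp flip: cn)
    moreover have "(\<Sum>n<N. cnj (a n) * of_real (r ^ (2 * n)) * (\<Sum>m<N. a m * (c t ^ m / c t ^ n)))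
        = P * cnj P"
    proof -
      have "(\<Sum>n<N. cnj (a n) * of_real (r ^ (2 * n)) * (\<Sum>m<N. a m * (c t ^ m / c t ^ n)))
        = (\<Sum>n<N. P * (cnj (a n) * cnj (c t) ^ n))"
        unfolding P_def sum_distrib_left sum_distrib_right
        by (intro sum.cong refl) (simp flip: cn)
      then show ?thesis by (simp add: P_def sum_distrib_left)
    qed
    ultimately have Heq: "H t = G (c t) - 2 * (F (c t) * cnj P) + P * cnj P"
      by (simp add: H_def)
    have "(cmod (F (c t)))\<^sup>2 \<le> Re (G (c t))"
      using ct r by (intro le) simp
    moreover have "Re (G (c t) - 2 * (F (c t) * cnj P) + P * cnj P)
        = Re (G (c t)) - (cmod (F (c t)))\<^sup>2 + (cmod (F (c t) - P))\<^sup>2"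
      by (simp only: cmod_power2) (simp add: power2_eq_square algebra_simps)
    ultimately show ?thesis
      unfolding Heq using zero_le_power2[of "cmod (F (c t) - P)"] by linarith
  qed
  ultimately have "0 \<le> Re (G 0 - 2 * A + A)"
    by (meson has_integral_nonneg)
  moreover have "Re A = (\<Sum>n<N. (cmod (a n))\<^sup>2 * r ^ (2 * n))"
    unfolding A_def Re_sum
    by (intro sum.cong refl, simp only: cmod_power2)
      (simp add: power2_eq_square algebra_simps flip: of_real_power)
  ultimately show ?thesis by (simp add: a_def)
qed

text \<open>Only finitely many coefficients occur, so the bound on circles of radius r < 1 passes to
  the limit; its right side does not depend on r.\<close>

lemma sum_maclaurin_le_majorant:
  assumes F: "F holomorphic_on unit_disc" and G: "G holomorphic_on unit_disc"
    and le: "\<And>z. z \<in> unit_disc \<Longrightarrow> (cmod (F z))\<^sup>2 \<le> Re (G z)"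
  shows "(\<Sum>n<N. (cmod (maclaurin F n))\<^sup>2) \<le> Re (G 0)"
proof (rule tendsto_upperbound)
  have "((\<lambda>r. \<Sum>n<N. (cmod (maclaurin F n))\<^sup>2 * r ^ (2 * n)) \<longlongrightarrow>
      (\<Sum>n<N. (cmod (maclaurin F n))\<^sup>2 * 1 ^ (2 * n))) (at_left (1::real))"
    by (intro tendsto_intros)
  then show "((\<lambda>r. \<Sum>n<N. (cmod (maclaurin F n))\<^sup>2 * r ^ (2 * n)) \<longlongrightarrow>
      (\<Sum>n<N. (cmod (maclaurin F n))\<^sup>2)) (at_left (1::real))"
    by simp
  show "\<forall>\<^sub>F r in at_left (1::real). (\<Sum>n<N. (cmod (maclaurin F n))\<^sup>2 * r ^ (2 * n)) \<le> Re (G 0)"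
    by (rule eventually_at_leftI[of 0]) (auto intro: sum_maclaurin_le_majorant_scaled[OF F G le])
qed simp

lemma in_hardy2I_majorant:
  assumes F: "F holomorphic_on unit_disc" and G: "G holomorphic_on unit_disc"
    and le: "\<And>z. z \<in> unit_disc \<Longrightarrow> (cmod (F z))\<^sup>2 \<le> Re (G z)"
    and "\<And>z. z \<notin> unit_disc \<Longrightarrow> F z = 0"
  shows "in_hardy2 F"
  unfolding in_hardy2_def using assms sum_maclaurin_le_majorant[OF F G le]
  by (auto intro!: summableI_nonneg_bounded[where x = "Re (G 0)"])

text \<open>An explicit analytic completion of the Poisson integral of the squared modulus. For p =
  a 0 + z g, expand |p|^2 and replace |z g|^2 by |g|^2; this is an equality on the unit circle, so
  nothing is lost and \<open>G 0\<close> is exactly the sum of squares.\<close>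

lemma polynomial_majorant:
  fixes a :: "nat \<Rightarrow> complex"
  shows "\<exists>G. G holomorphic_on unit_disc \<and> G 0 = of_real (\<Sum>k<N. (cmod (a k))\<^sup>2) \<and>
    (\<forall>z\<in>unit_disc. (cmod (\<Sum>k<N. a k * z ^ k))\<^sup>2 \<le> Re (G z))"
proof (induction N arbitrary: a)
  case 0
  show ?case by (intro exI[of _ "\<lambda>z. 0"]) auto
next
  case (Suc N)
  define g where "g z = (\<Sum>k<N. a (Suc k) * z ^ k)" for z
  obtain G where G: "G holomorphic_on unit_disc" "G 0 = of_real (\<Sum>k<N. (cmod (a (Suc k)))\<^sup>2)"
    "\<And>z. z \<in> unit_disc \<Longrightarrow> (cmod (g z))\<^sup>2 \<le> Re (G z)"
    using Suc.IH[of "\<lambda>k. a (Suc k)"] by (auto simp: g_def)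
  define G' where "G' z = of_real ((cmod (a 0))\<^sup>2) + 2 * cnj (a 0) * z * g z + G z" for z
  have "G' holomorphic_on unit_disc"
    unfolding G'_def g_def by (intro holomorphic_intros G)
  moreover have "G' 0 = of_real (\<Sum>k<Suc N. (cmod (a k))\<^sup>2)"
    using G(2) by (simp add: G'_def sum.lessThan_Suc_shift del: sum.lessThan_Suc)
  moreover have "(cmod (\<Sum>k<Suc N. a k * z ^ k))\<^sup>2 \<le> Re (G' z)" if z: "z \<in> unit_disc" for z
  proof -
    have "(\<Sum>k<Suc N. a k * z ^ k) = a 0 + z * g z"
      by (simp add: sum.lessThan_Suc_shift g_def sum_distrib_left mult_ac del: sum.lessThan_Suc)
    then have "(cmod (\<Sum>k<Suc N. a k * z ^ k))\<^sup>2 =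
        (cmod (a 0))\<^sup>2 + Re (2 * cnj (a 0) * (z * g z)) + (cmod (z * g z))\<^sup>2"
      by (simp only: cmod_power2) (simp add: power2_eq_square algebra_simps)
    moreover have "(cmod (z * g z))\<^sup>2 \<le> (cmod (g z))\<^sup>2"
      using z by (intro power_mono) (auto simp: norm_mult mult_left_le_one_le)
    ultimately show ?thesis
      using G(3)[OF z] unfolding G'_def plus_complex.sel Re_complex_of_real mult.assoc by linarith
  qed
  ultimately show ?case by blast
qed

text \<open>The Cayley transform of \<open>W\<close> fixes 0 and maps into the disc, so the Schwarz
  lemma applies. The shift by \<open>e\<close> makes the real part strictly positive, which keeps
  the denominator nonzero even for c = 0; it disappears in the limit.\<close>

lemma Harnack_Re_le:
  assumes G: "G holomorphic_on unit_disc" "\<And>z. z \<in> unit_disc \<Longrightarrow> 0 \<le> Re (G z)"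
    and G0: "G 0 = of_real c" and p: "p \<in> unit_disc"
  shows "Re (G p) \<le> (1 + cmod p) / (1 - cmod p) * c"
proof -
  have "Re (G p) \<le> (1 + cmod p) / (1 - cmod p) * (c + e)" if e: "e > 0" for e
  proof -
    define d where "d = c + e"
    define W where "W z = G z + of_real e" for z
    have ReW: "Re (W z) > 0" if "z \<in> unit_disc" for z
      using G(2)[OF that] e by (simp add: W_def)
    have d: "d > 0" using ReW[of 0] G0 by (simp add: W_def d_def)
    have nz: "W z + of_real d \<noteq> 0" if "z \<in> unit_disc" for z
      using ReW[OF that] d by (metis Re_complex_of_real add_pos_pos less_irrefl plus_complex.sel(1) zero_complex.sel(1))
    have less: "cmod (W z - of_real d) < cmod (W z + of_real d)" if "z \<in> unit_disc" for z
    proof (rule power2_less_imp_less)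
      show "(cmod (W z - of_real d))\<^sup>2 < (cmod (W z + of_real d))\<^sup>2"
        using mult_pos_pos[OF ReW[OF that] d]
        by (simp only: cmod_power2) (simp add: power2_eq_square algebra_simps)
    qed simp
    have "cmod ((\<lambda>z. (W z - of_real d) / (W z + of_real d)) p) \<le> cmod p"
    proof (rule Schwarz_Lemma(1))
      show "(\<lambda>z. (W z - of_real d) / (W z + of_real d)) holomorphic_on ball 0 1"
        using nz unfolding W_def by (intro holomorphic_intros G) auto
      show "(W 0 - of_real d) / (W 0 + of_real d) = 0"
        using G0 by (simp add: W_def d_def)
      show "cmod ((W z - of_real d) / (W z + of_real d)) < 1" if "cmod z < 1" for z
        using less[of z] nz[of z] that by (simp add: norm_divide)
      show "cmod p < 1" using p by simp
    qed
    then have "cmod (W p - of_real d) \<le> cmod p * cmod (W p + of_real d)"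
      using nz[OF p] by (simp add: norm_divide field_simps)
    moreover have "cmod (W p) - d \<le> cmod (W p - of_real d)"
      using norm_triangle_ineq2[of "W p" "of_real d"] d by simp
    moreover have "cmod p * cmod (W p + of_real d) \<le> cmod p * (cmod (W p) + d)"
      using norm_triangle_ineq[of "W p" "of_real d"] d by (intro mult_left_mono) auto
    ultimately have "cmod (W p) * (1 - cmod p) \<le> (1 + cmod p) * d"
      by (simp add: algebra_simps)
    then have "cmod (W p) \<le> (1 + cmod p) / (1 - cmod p) * d"
      using p by (simp add: field_simps)
    moreover have "Re (G p) \<le> cmod (W p)"
      using complex_Re_le_cmod[of "W p"] e by (simp add: W_def)
    ultimately show ?thesis by (simp add: d_def)
  qed
  then have "((\<lambda>e. (1 + cmod p) / (1 - cmod p) * (c + e)) \<longlongrightarrow> (1 + cmod p) / (1 - cmod p) * (c + 0)) (at_right 0)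
      \<Longrightarrow> Re (G p) \<le> (1 + cmod p) / (1 - cmod p) * (c + 0)"
    by (intro tendsto_lowerbound) (auto simp: eventually_at_filter)
  moreover have "((\<lambda>e. (1 + cmod p) / (1 - cmod p) * (c + e)) \<longlongrightarrow> (1 + cmod p) / (1 - cmod p) * (c + 0)) (at_right 0)"
    by (intro tendsto_intros)
  ultimately show ?thesis by simp
qed

section \<open>Littlewood's subordination bound and powers of the composition operator\<close>

lemma cmod_maclaurin_le_norm: "cmod (maclaurin (fun_of f) k) \<le> norm f"
proof -
  have "(cmod (maclaurin (fun_of f) k))\<^sup>2 \<le> (\<Sum>n. (cmod (maclaurin (fun_of f) n))\<^sup>2)"
    using sum_le_suminf[OF summable_fun_of, of "{k}"] by simp
  then show ?thesis
    unfolding norm_hardy2_eq by (rule real_le_rsqrt)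
qed

lemma sum_maclaurin_le_norm: "(\<Sum>k<N. (cmod (maclaurin (fun_of f) k))\<^sup>2) \<le> (norm f)\<^sup>2"
  unfolding norm_hardy2_eq using sum_le_suminf[OF summable_fun_of, of "{..<N}" f]
  by (simp add: suminf_nonneg summable_fun_of)

lemma fun_of_sums:
  assumes "z \<in> unit_disc"
  shows "(\<lambda>n. maclaurin (fun_of f) n * z ^ n) sums fun_of f z"
  using holomorphic_power_series[OF holomorphic_fun_of assms, of f] by (simp add: maclaurin_def)

text \<open>A crude bound on point evaluations; it turns norm convergence into uniform convergence
  on smaller discs.\<close>

lemma cmod_fun_of_le:
  assumes z: "z \<in> unit_disc"
  shows "cmod (fun_of f z) \<le> norm f / (1 - cmod z)"
proof -
  have le: "norm (maclaurin (fun_of f) n * z ^ n) \<le> norm f * cmod z ^ n" for n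
    using cmod_maclaurin_le_norm[of f n] by (simp add: norm_mult norm_power mult_right_mono)
  have s: "summable (\<lambda>n. norm f * cmod z ^ n)"
    using z by (intro summable_mult summable_geometric) auto
  have s': "summable (\<lambda>n. norm (maclaurin (fun_of f) n * z ^ n))"
    by (rule summable_comparison_test[OF _ s]) (use le in auto)
  have "cmod (fun_of f z) \<le> (\<Sum>n. norm (maclaurin (fun_of f) n * z ^ n))"
    using summable_norm[OF s'] sums_unique[OF fun_of_sums[OF z, of f]] by simp
  also have "\<dots> \<le> (\<Sum>n. norm f * cmod z ^ n)"
    by (rule suminf_le[OF le s' s])
  also have "\<dots> = norm f / (1 - cmod z)"
    using z by (subst suminf_mult) (auto simp: suminf_geometric intro: summable_geometric)
  finally show ?thesis .
qed

lemma selfmap_in_disc: "selfmap \<phi> \<Longrightarrow> z \<in> unit_disc \<Longrightarrow> \<phi> z \<in> unit_disc"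
  unfolding selfmap_def by blast

lemma fun_of_outside: "z \<notin> unit_disc \<Longrightarrow> fun_of f z = 0"
  using in_hardy2_fun_of[of f] by (simp add: in_hardy2_def)

lemma holomorphic_on_disc_comp:
  assumes "selfmap \<phi>" "g holomorphic_on unit_disc"
  shows "(\<lambda>z. if z \<in> unit_disc then g (\<phi> z) else 0) holomorphic_on unit_disc"
proof -
  have "(\<lambda>z. g (\<phi> z)) holomorphic_on unit_disc"
    using holomorphic_on_compose_gen[of \<phi> unit_disc g unit_disc] assms
    unfolding selfmap_def o_def by blast
  then show ?thesis by (rule holomorphic_transform) simp
qed

text \<open>Reduces subordination to polynomials. Near 0 the values of \<phi> stay in a closed disc
  of radius R < 1, where the power series of \<open>f\<close> converges uniformly, and uniform
  convergence of holomorphic functions passes to the derivatives at 0.\<close>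

lemma maclaurin_comp_limit:
  assumes \<phi>: "selfmap \<phi>"
  shows "(\<lambda>N. maclaurin (\<lambda>z. if z \<in> unit_disc then (\<Sum>k<N. maclaurin (fun_of f) k * \<phi> z ^ k) else 0) n)
    \<longlonglongrightarrow> maclaurin (\<lambda>z. if z \<in> unit_disc then fun_of f (\<phi> z) else 0) n"
proof -
  define a where "a = maclaurin (fun_of f)"
  define A where "A = ball (0::complex) (1/2)"
  have "compact (\<phi> ` cball 0 (1/2))"
    using \<phi> unfolding selfmap_def
    by (intro compact_continuous_image holomorphic_on_imp_continuous_on)
      (auto intro: holomorphic_on_subset)
  moreover have "\<phi> ` cball 0 (1/2) \<noteq> {}" by simp
  ultimately obtain w where w: "w \<in> \<phi> ` cball 0 (1/2)"
    "\<And>v. v \<in> \<phi> ` cball 0 (1/2) \<Longrightarrow> cmod v \<le> cmod w"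
    using continuous_attains_sup[of "\<phi> ` cball 0 (1/2)" cmod] by (auto intro: continuous_intros)
  define R where "R = cmod w"
  have R: "0 \<le> R" "R < 1"
    using w(1) selfmap_in_disc[OF \<phi>] unfolding R_def by force+
  have "uniform_limit A (\<lambda>N z. \<Sum>k<N. a k * \<phi> z ^ k) (\<lambda>z. \<Sum>k. a k * \<phi> z ^ k) sequentially"
  proof (rule Weierstrass_m_test)
    show "norm (a k * \<phi> z ^ k) \<le> norm f * R ^ k" if "z \<in> A" for k z
      using that w(2)[of "\<phi> z"] cmod_maclaurin_le_norm[of f k]
      by (auto simp: norm_mult norm_power A_def R_def a_def intro!: mult_mono power_mono)
    show "summable (\<lambda>k. norm f * R ^ k)"
      using R by (intro summable_mult summable_geometric) auto
  qed
  then have "uniform_limit A (\<lambda>N z. if z \<in> unit_disc then \<Sum>k<N. a k * \<phi> z ^ k else 0)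
      (\<lambda>z. if z \<in> unit_disc then fun_of f (\<phi> z) else 0) sequentially"
  proof (rule uniform_limit_cong'[THEN iffD1, rotated -1])
    show "(\<Sum>k. a k * \<phi> z ^ k) = (if z \<in> unit_disc then fun_of f (\<phi> z) else 0)" if "z \<in> A" for z
      using that sums_unique[OF fun_of_sums[OF selfmap_in_disc[OF \<phi>], of z f]] by (simp add: A_def a_def)
  qed (simp add: A_def)
  then have lim: "(\<lambda>N. (deriv ^^ n) (\<lambda>z. if z \<in> unit_disc then \<Sum>k<N. a k * \<phi> z ^ k else 0) 0)
      \<longlonglongrightarrow> (deriv ^^ n) (\<lambda>z. if z \<in> unit_disc then fun_of f (\<phi> z) else 0) 0"
  proof (rule higher_deriv_complex_uniform_limit)
    show "\<forall>\<^sub>F N in sequentially. (\<lambda>z. if z \<in> unit_disc then \<Sum>k<N. a k * \<phi> z ^ k else 0) holomorphic_on A"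
    proof (intro always_eventually allI)
      fix N
      have "(\<lambda>w. \<Sum>k<N. a k * w ^ k) holomorphic_on unit_disc" by (intro holomorphic_intros)
      from holomorphic_on_disc_comp[OF \<phi> this]
      show "(\<lambda>z. if z \<in> unit_disc then \<Sum>k<N. a k * \<phi> z ^ k else 0) holomorphic_on A"
        by (rule holomorphic_on_subset) (auto simp: A_def)
    qed
  qed (auto simp: A_def)
  show ?thesis
    unfolding a_def[symmetric] unfolding maclaurin_def
    by (rule tendsto_divide[OF lim tendsto_const]) simp
qed

text \<open>Littlewood's argument: if \<open>Re (G z)\<close> majorizes the squared modulus of a
  Taylor polynomial of \<open>f\<close>, then \<open>Re (G (\<phi> z))\<close> majorizes that of the
  composite, and its value at 0 is at most the Harnack factor at \<phi>(0) times
  \<open>Re (G 0)\<close>. \<open>M\<close> stays fixed while the degree of the polynomial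
  grows.\<close>

lemma sum_maclaurin_comp_le:
  assumes \<phi>: "selfmap \<phi>"
  shows "(\<Sum>n<M. (cmod (maclaurin (\<lambda>z. if z \<in> unit_disc then fun_of f (\<phi> z) else 0) n))\<^sup>2)
    \<le> (1 + cmod (\<phi> 0)) / (1 - cmod (\<phi> 0)) * (norm f)\<^sup>2"
proof (rule tendsto_upperbound)
  let ?F = "\<lambda>N z. if z \<in> unit_disc then (\<Sum>k<N. maclaurin (fun_of f) k * \<phi> z ^ k) else 0"
  show "(\<lambda>N. \<Sum>n<M. (cmod (maclaurin (?F N) n))\<^sup>2) \<longlonglongrightarrow>
      (\<Sum>n<M. (cmod (maclaurin (\<lambda>z. if z \<in> unit_disc then fun_of f (\<phi> z) else 0) n))\<^sup>2)"
    by (intro tendsto_sum tendsto_power tendsto_norm maclaurin_comp_limit[OF \<phi>])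
  have "(\<Sum>n<M. (cmod (maclaurin (?F N) n))\<^sup>2) \<le> (1 + cmod (\<phi> 0)) / (1 - cmod (\<phi> 0)) * (norm f)\<^sup>2" for N
  proof -
    have p: "\<phi> 0 \<in> unit_disc" by (rule selfmap_in_disc[OF \<phi>]) simp
    obtain G where G: "G holomorphic_on unit_disc"
      "G 0 = of_real (\<Sum>k<N. (cmod (maclaurin (fun_of f) k))\<^sup>2)"
      "\<And>z. z \<in> unit_disc \<Longrightarrow> (cmod (\<Sum>k<N. maclaurin (fun_of f) k * z ^ k))\<^sup>2 \<le> Re (G z)"
      using polynomial_majorant[where N = N and a = "maclaurin (fun_of f)"] by blast
    have "(\<lambda>w. \<Sum>k<N. maclaurin (fun_of f) k * w ^ k) holomorphic_on unit_disc"
      by (intro holomorphic_intros)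
    from holomorphic_on_disc_comp[OF \<phi> this] have "?F N holomorphic_on unit_disc" .
    from sum_maclaurin_le_majorant[OF this holomorphic_on_disc_comp[OF \<phi> G(1)], of M]
    have "(\<Sum>n<M. (cmod (maclaurin (?F N) n))\<^sup>2) \<le> Re (G (\<phi> 0))"
      using G(3) selfmap_in_disc[OF \<phi>] by simp
    also have "\<dots> \<le> (1 + cmod (\<phi> 0)) / (1 - cmod (\<phi> 0)) * (\<Sum>k<N. (cmod (maclaurin (fun_of f) k))\<^sup>2)"
    proof (rule Harnack_Re_le[OF G(1) _ G(2) p])
      show "0 \<le> Re (G z)" if "z \<in> unit_disc" for z
        using G(3)[OF that] by (rule order_trans[rotated]) simp
    qed
    also have "\<dots> \<le> (1 + cmod (\<phi> 0)) / (1 - cmod (\<phi> 0)) * (norm f)\<^sup>2"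
      using p by (intro mult_left_mono sum_maclaurin_le_norm) auto
    finally show ?thesis .
  qed
  then show "\<forall>\<^sub>F N in sequentially. (\<Sum>n<M. (cmod (maclaurin (?F N) n))\<^sup>2)
      \<le> (1 + cmod (\<phi> 0)) / (1 - cmod (\<phi> 0)) * (norm f)\<^sup>2"
    by simp
qed simp

lemma in_hardy2_comp:
  assumes \<phi>: "selfmap \<phi>"
  shows "in_hardy2 (\<lambda>z. if z \<in> unit_disc then fun_of f (\<phi> z) else 0)"
  unfolding in_hardy2_def
  using holomorphic_on_disc_comp[OF \<phi> holomorphic_fun_of, of f] sum_maclaurin_comp_le[OF \<phi>, of f]
  by (auto intro!: summableI_nonneg_bounded[where x = "(1 + cmod (\<phi> 0)) / (1 - cmod (\<phi> 0)) * (norm f)\<^sup>2"])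

lemma fun_of_comp_op:
  assumes "selfmap \<phi>"
  shows "fun_of (comp_op \<phi> f) = (\<lambda>z. if z \<in> unit_disc then fun_of f (\<phi> z) else 0)"
  unfolding comp_op_def using in_hardy2_comp[OF assms] by (simp add: Abs_hardy2_inverse)

lemma norm_comp_op_le:
  assumes \<phi>: "selfmap \<phi>"
  shows "norm (comp_op \<phi> f) \<le> sqrt ((1 + cmod (\<phi> 0)) / (1 - cmod (\<phi> 0))) * norm f"
proof -
  have "(\<Sum>n. (cmod (maclaurin (fun_of (comp_op \<phi> f)) n))\<^sup>2)
      \<le> (1 + cmod (\<phi> 0)) / (1 - cmod (\<phi> 0)) * (norm f)\<^sup>2"
    using sum_maclaurin_comp_le[OF \<phi>, of f]
    by (intro suminf_le_const summable_fun_of) (simp add: fun_of_comp_op[OF \<phi>])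
  then have "norm (comp_op \<phi> f) \<le> sqrt ((1 + cmod (\<phi> 0)) / (1 - cmod (\<phi> 0)) * (norm f)\<^sup>2)"
    unfolding norm_hardy2_eq[of "comp_op \<phi> f"] by (rule real_sqrt_le_mono)
  then show ?thesis by (simp only: real_sqrt_mult real_sqrt_abs abs_norm_cancel)
qed

lemma hardy2_eqI: "(\<And>z. z \<in> unit_disc \<Longrightarrow> fun_of f z = fun_of g z) \<Longrightarrow> f = g"
  by (metis ext fun_of_inject fun_of_outside)

lemma bounded_clinear_comp_op:
  assumes \<phi>: "selfmap \<phi>"
  shows "bounded_clinear (comp_op \<phi>)"
proof -
  have add: "comp_op \<phi> (f + g) = comp_op \<phi> f + comp_op \<phi> g" for f g
    by (rule hardy2_eqI) (simp add: fun_of_comp_op[OF \<phi>] fun_of_add)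
  have scale: "comp_op \<phi> (c *\<^sub>C f) = c *\<^sub>C comp_op \<phi> f" for c f
    by (rule hardy2_eqI) (simp add: fun_of_comp_op[OF \<phi>] scaleC_hardy2.rep_eq)
  have "bounded_linear (comp_op \<phi>)"
    by (rule bounded_linear_intro[where K = "sqrt ((1 + cmod (\<phi> 0)) / (1 - cmod (\<phi> 0)))"])
      (use norm_comp_op_le[OF \<phi>] in \<open>simp_all add: add scale scaleC_of_real[symmetric] mult.commute\<close>)
  then show ?thesis using scale by (simp add: bounded_clinear_def)
qed

lemma selfmap_funpow: "selfmap \<phi> \<Longrightarrow> selfmap (\<phi> ^^ n)"
proof (induction n)
  case 0
  show ?case by (auto simp: selfmap_def id_def)
next
  case (Suc n)
  then have "\<phi> ^^ n holomorphic_on unit_disc" "(\<phi> ^^ n) ` unit_disc \<subseteq> unit_disc"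
    "\<phi> holomorphic_on unit_disc" "\<phi> ` unit_disc \<subseteq> unit_disc"
    by (simp_all add: selfmap_def)
  then show ?case
    unfolding selfmap_def funpow.simps image_comp[symmetric]
    by (blast intro: holomorphic_on_compose_gen)
qed

lemma comp_op_funpow:
  assumes \<phi>: "selfmap \<phi>"
  shows "(comp_op \<phi> ^^ n) f = comp_op (\<phi> ^^ n) f"
proof (induction n)
  case 0
  show ?case
  proof (rule hardy2_eqI)
    fix z :: complex assume "z \<in> unit_disc"
    then have "fun_of (comp_op (\<phi> ^^ 0) f) z = fun_of f z"
      by (subst fun_of_comp_op[OF selfmap_funpow[OF \<phi>]]) simp
    then show "fun_of ((comp_op \<phi> ^^ 0) f) z = fun_of (comp_op (\<phi> ^^ 0) f) z"
      by (simp only: funpow_0)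
  qed
next
  case (Suc n)
  show ?case
  proof (rule hardy2_eqI)
    fix z :: complex assume z: "z \<in> unit_disc"
    have "fun_of ((comp_op \<phi> ^^ Suc n) f) z = fun_of f ((\<phi> ^^ n) (\<phi> z))"
      using z selfmap_in_disc[OF \<phi> z] by (simp add: Suc fun_of_comp_op \<phi> selfmap_funpow)
    also have "\<dots> = fun_of (comp_op (\<phi> ^^ Suc n) f) z"
      using z by (subst fun_of_comp_op[OF selfmap_funpow[OF \<phi>]]) (simp add: funpow_swap1)
    finally show "fun_of ((comp_op \<phi> ^^ Suc n) f) z = fun_of (comp_op (\<phi> ^^ Suc n) f) z" .
  qed
qed

section \<open>Completeness of the Hardy space\<close>

lemma fun_of_diff: "fun_of (f - g) = (\<lambda>z. fun_of f z - fun_of g z)"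
  by (rule minus_hardy2.rep_eq)

lemma maclaurin_diff:
  assumes "f holomorphic_on unit_disc" "g holomorphic_on unit_disc"
  shows "maclaurin (\<lambda>z. f z - g z) n = maclaurin f n - maclaurin g n"
  unfolding maclaurin_def using higher_deriv_diff[OF assms, of 0 n] by (simp add: diff_divide_distrib)

text \<open>A Cauchy sequence converges locally uniformly, hence coefficientwise, to a holomorphic
  \<open>g\<close>. The Cauchy estimate on finitely many coefficients, passed to the limit in
  \<open>m\<close>, controls the norm of the difference of \<open>g\<close> and \<open>X n\<close>;
  this gives both membership of \<open>g\<close> and convergence to it.\<close>

instance hardy2 :: banach
proof
  fix X :: "nat \<Rightarrow> hardy2"
  assume X: "Cauchy X"
  have unif: "\<exists>g. uniform_limit (cball 0 R) (\<lambda>n. fun_of (X n)) g sequentially" if R: "0 \<le> R" "R < 1" for R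
  proof -
    have "uniformly_Cauchy_on (cball 0 R) (\<lambda>n. fun_of (X n))"
    proof (rule uniformly_Cauchy_onI)
      fix e :: real assume e: "e > 0"
      then obtain M where M: "\<And>m n. m \<ge> M \<Longrightarrow> n \<ge> M \<Longrightarrow> norm (X m - X n) < e * (1 - R)"
        using CauchyD[OF X, of "e * (1 - R)"] R by auto
      have "dist (fun_of (X m) z) (fun_of (X n) z) < e" if z: "z \<in> cball 0 R" and mn: "m \<ge> M" "n \<ge> M" for z m n
      proof -
        have "cmod (fun_of (X m - X n) z) \<le> norm (X m - X n) / (1 - cmod z)"
          using z R by (intro cmod_fun_of_le) auto
        also have "\<dots> \<le> norm (X m - X n) / (1 - R)"
          using z R by (intro divide_left_mono) auto
        also have "\<dots> < e" using M[OF mn] R by (simp add: field_simps)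
        finally show ?thesis by (simp add: fun_of_diff dist_norm)
      qed
      then show "\<exists>M. \<forall>z\<in>cball 0 R. \<forall>m\<ge>M. \<forall>n\<ge>M. dist (fun_of (X m) z) (fun_of (X n) z) < e" by blast
    qed
    then show ?thesis
      by (auto simp: uniformly_convergent_eq_Cauchy[symmetric] uniformly_convergent_on_def)
  qed
  define g where "g z = (if z \<in> unit_disc then lim (\<lambda>n. fun_of (X n) z) else 0)" for z
  have ug: "uniform_limit (cball 0 R) (\<lambda>n. fun_of (X n)) g sequentially" if R: "0 \<le> R" "R < 1" for R
  proof -
    obtain g' where g': "uniform_limit (cball 0 R) (\<lambda>n. fun_of (X n)) g' sequentially"
      using unif[OF R] by blast
    have "g' z = g z" if z: "z \<in> cball 0 R" for z
      using limI[OF tendsto_uniform_limitI[OF g' z]] z R by (simp add: g_def)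
    then show ?thesis
      using uniform_limit_cong'[of "cball 0 R" "\<lambda>n. fun_of (X n)" "\<lambda>n. fun_of (X n)" g' g] g' by auto
  qed
  have hg: "g holomorphic_on unit_disc"
  proof (rule holomorphic_uniform_sequence[OF _ holomorphic_fun_of])
    fix z :: complex assume z: "z \<in> unit_disc"
    define d where "d = (1 - cmod z) / 2"
    have sub: "cball z d \<subseteq> cball 0 (cmod z + d)"
    proof
      fix w assume "w \<in> cball z d"
      then show "w \<in> cball 0 (cmod z + d)"
        using norm_triangle_ineq[of z "w - z"] by (simp add: dist_norm norm_minus_commute)
    qed
    have R: "0 \<le> cmod z + d" "cmod z + d < 1" "0 < d" using z by (auto simp: d_def field_simps)
    then have "cball z d \<subseteq> unit_disc" using sub by force
    then show "\<exists>d>0. cball z d \<subseteq> unit_disc \<and> uniform_limit (cball z d) (\<lambda>n. fun_of (X n)) g sequentially"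
      using uniform_limit_on_subset[OF ug[OF R(1,2)] sub] R by blast
  qed simp
  have coeff: "(\<lambda>n. maclaurin (fun_of (X n)) k) \<longlonglongrightarrow> maclaurin g k" for k
  proof -
    have "(\<lambda>n. (deriv ^^ k) (fun_of (X n)) 0) \<longlonglongrightarrow> (deriv ^^ k) g 0"
    proof (rule higher_deriv_complex_uniform_limit[where A = "ball 0 (1/2)"])
      show "uniform_limit (ball 0 (1/2)) (\<lambda>n. fun_of (X n)) g sequentially"
        by (rule uniform_limit_on_subset[OF ug[of "1/2"]]) auto
      show "\<forall>\<^sub>F n in sequentially. fun_of (X n) holomorphic_on ball 0 (1/2)"
        by (intro always_eventually allI holomorphic_on_subset[OF holomorphic_fun_of]) auto
    qed auto
    then show ?thesis unfolding maclaurin_def by (intro tendsto_divide) auto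
  qed
  have partial: "(\<Sum>k<K. (cmod (maclaurin (\<lambda>z. g z - fun_of (X n) z) k))\<^sup>2) \<le> e\<^sup>2"
    if M: "\<And>m n. m \<ge> M \<Longrightarrow> n \<ge> M \<Longrightarrow> norm (X m - X n) < e" and n: "n \<ge> M" for K M n e
  proof (rule tendsto_upperbound)
    show "(\<lambda>m. \<Sum>k<K. (cmod (maclaurin (fun_of (X m)) k - maclaurin (fun_of (X n)) k))\<^sup>2) \<longlonglongrightarrow>
        (\<Sum>k<K. (cmod (maclaurin (\<lambda>z. g z - fun_of (X n) z) k))\<^sup>2)"
      unfolding maclaurin_diff[OF hg holomorphic_fun_of]
      by (intro tendsto_sum tendsto_power tendsto_norm tendsto_diff coeff tendsto_const)
    have "(\<Sum>k<K. (cmod (maclaurin (fun_of (X m)) k - maclaurin (fun_of (X n)) k))\<^sup>2) \<le> e\<^sup>2" if "m \<ge> M" for m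
    proof -
      have "(\<Sum>k<K. (cmod (maclaurin (fun_of (X m)) k - maclaurin (fun_of (X n)) k))\<^sup>2) \<le> (norm (X m - X n))\<^sup>2"
        using sum_maclaurin_le_norm[of "X m - X n" K]
        by (simp add: fun_of_diff maclaurin_diff holomorphic_fun_of)
      also have "\<dots> \<le> e\<^sup>2" using M[OF that n] by (intro power_mono) auto
      finally show ?thesis .
    qed
    then show "\<forall>\<^sub>F m in sequentially. (\<Sum>k<K. (cmod (maclaurin (fun_of (X m)) k - maclaurin (fun_of (X n)) k))\<^sup>2) \<le> e\<^sup>2"
      using eventually_sequentially by blast
  qed simp
  have hgX: "(\<lambda>z. g z - fun_of (X n) z) holomorphic_on unit_disc" for n
    by (intro holomorphic_intros hg holomorphic_fun_of)
  have diff_in: "in_hardy2 (\<lambda>z. g z - fun_of (X n) z)"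
    if M: "\<And>m n. m \<ge> M \<Longrightarrow> n \<ge> M \<Longrightarrow> norm (X m - X n) < e" and n: "n \<ge> M" for M n e
    unfolding in_hardy2_def using hgX partial[OF M n]
    by (auto simp: g_def fun_of_outside intro!: summableI_nonneg_bounded[where x = "e\<^sup>2"])
  obtain M1 where M1: "\<And>m n. m \<ge> M1 \<Longrightarrow> n \<ge> M1 \<Longrightarrow> norm (X m - X n) < 1"
    using CauchyD[OF X, of 1] by auto
  have "in_hardy2 (\<lambda>z. (g z - fun_of (X M1) z) + fun_of (X M1) z)"
    by (rule in_hardy2_add[OF diff_in[OF M1] in_hardy2_fun_of]) auto
  then have "in_hardy2 g" by simp
  then obtain Y where Y: "fun_of Y = g" using Abs_hardy2_inverse by blast
  have "X \<longlonglongrightarrow> Y"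
  proof (rule LIMSEQ_I)
    fix e :: real assume e: "e > 0"
    then obtain M where M: "\<And>m n. m \<ge> M \<Longrightarrow> n \<ge> M \<Longrightarrow> norm (X m - X n) < e / 2"
      using CauchyD[OF X, of "e / 2"] by auto
    have "norm (X n - Y) < e" if n: "n \<ge> M" for n
    proof -
      have "(\<Sum>k. (cmod (maclaurin (fun_of (Y - X n)) k))\<^sup>2) \<le> (e / 2)\<^sup>2"
        by (rule suminf_le_const[OF summable_fun_of])
          (use partial[OF M n] in \<open>simp add: fun_of_diff Y\<close>)
      then have "norm (Y - X n) \<le> sqrt ((e / 2)\<^sup>2)"
        unfolding norm_hardy2_eq by (rule real_sqrt_le_mono)
      then show ?thesis using e by (simp add: norm_minus_commute)
    qed
    then show "\<exists>M. \<forall>n\<ge>M. norm (X n - Y) < e" by blast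
  qed
  then show "convergent X" by (rule convergentI)
qed


section \<open>Boundary behaviour of the symbol\<close>

text \<open>The identity by which disc automorphisms preserve the disc; it also converts the
  Schwarz-Pick estimate from pseudohyperbolic distances to the factors 1 - |z|^2.\<close>

lemma cmod_one_minus_cnj_mult:
  "(cmod (1 - cnj w * u))\<^sup>2 = (cmod (u - w))\<^sup>2 + (1 - (cmod w)\<^sup>2) * (1 - (cmod u)\<^sup>2)"
  unfolding cmod_power2 by (simp add: power2_eq_square algebra_simps)

lemma one_minus_cnj_mult_nonzero:
  assumes "w \<in> unit_disc" "u \<in> unit_disc"
  shows "1 - cnj w * u \<noteq> 0"
proof
  assume "1 - cnj w * u = 0"
  then have "cmod w * cmod u = 1" by (metis complex_mod_cnj diff_eq_eq add_0 norm_mult norm_one)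
  moreover have "cmod w * cmod u < 1 * 1"
    using assms by (intro mult_strict_mono') auto
  ultimately show False by simp
qed

lemma disc_moebius_in_disc:
  assumes "w \<in> unit_disc" "u \<in> unit_disc"
  shows "(u - w) / (1 - cnj w * u) \<in> unit_disc"
proof -
  have "0 < (1 - (cmod w)\<^sup>2) * (1 - (cmod u)\<^sup>2)"
    using assms by (intro mult_pos_pos) (auto simp: power_less_one_iff)
  then have "(cmod (u - w))\<^sup>2 < (cmod (1 - cnj w * u))\<^sup>2"
    unfolding cmod_one_minus_cnj_mult by simp
  then have "cmod (u - w) < cmod (1 - cnj w * u)"
    by (rule power2_less_imp_less) simp
  then show ?thesis
    using one_minus_cnj_mult_nonzero[OF assms] by (simp add: norm_divide)
qed

text \<open>Disc automorphisms move \<open>w\<close> and \<phi>(w) to 0, and the Schwarz lemma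
  applies to \<open>g\<close>. The product form displays the factors that vanish at the boundary, so
  that they can be cancelled before a radial limit is taken.\<close>

lemma Schwarz_Pick:
  assumes \<phi>: "selfmap \<phi>" and z: "z \<in> unit_disc" and w: "w \<in> unit_disc"
  shows "(1 - (cmod z)\<^sup>2) * (1 - (cmod w)\<^sup>2) * (cmod (1 - cnj (\<phi> w) * \<phi> z))\<^sup>2
    \<le> (1 - (cmod (\<phi> z))\<^sup>2) * (1 - (cmod (\<phi> w))\<^sup>2) * (cmod (1 - cnj w * z))\<^sup>2"
proof -
  define M where "M u = (u + w) / (1 + cnj w * u)" for u
  define g where "g u = (\<phi> (M u) - \<phi> w) / (1 - cnj (\<phi> w) * \<phi> (M u))" for u
  define u0 where "u0 = (z - w) / (1 - cnj w * z)"
  have w': "- w \<in> unit_disc" using w by simp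
  have Mdisc: "M u \<in> unit_disc" "1 + cnj w * u \<noteq> 0" if "u \<in> unit_disc" for u
    using disc_moebius_in_disc[OF w' that] one_minus_cnj_mult_nonzero[OF w' that] by (simp_all add: M_def)
  have Mhol: "M holomorphic_on unit_disc"
    unfolding M_def using Mdisc(2) by (intro holomorphic_intros) auto
  have "(\<phi> \<circ> M) holomorphic_on unit_disc"
    by (rule holomorphic_on_compose_gen[OF Mhol]) (use \<phi> Mdisc in \<open>auto simp: selfmap_def\<close>)
  then have hol: "(\<lambda>u. \<phi> (M u)) holomorphic_on unit_disc" by (simp add: o_def)
  have ghol: "g holomorphic_on unit_disc"
    unfolding g_def
    by (intro holomorphic_intros hol one_minus_cnj_mult_nonzero selfmap_in_disc[OF \<phi>] w Mdisc)
  have g1: "g u \<in> unit_disc" if "u \<in> unit_disc" for u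
    unfolding g_def by (intro disc_moebius_in_disc selfmap_in_disc[OF \<phi>] w Mdisc that)
  have u0: "u0 \<in> unit_disc" unfolding u0_def by (rule disc_moebius_in_disc[OF w z])
  have nz: "1 - cnj w * z \<noteq> 0" by (rule one_minus_cnj_mult_nonzero[OF w z])
  have nz': "1 - cnj (\<phi> w) * \<phi> z \<noteq> 0"
    by (intro one_minus_cnj_mult_nonzero selfmap_in_disc[OF \<phi>] w z)
  have Mu0: "M u0 = z"
  proof -
    have "u0 + w = z * (1 - cnj w * w) / (1 - cnj w * z)"
      unfolding u0_def using nz by (simp add: field_simps)
    moreover have "1 + cnj w * u0 = (1 - cnj w * w) / (1 - cnj w * z)"
      unfolding u0_def using nz by (simp add: field_simps)
    moreover have "1 - cnj w * w \<noteq> 0" by (rule one_minus_cnj_mult_nonzero[OF w w])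
    ultimately show ?thesis unfolding M_def using nz by simp
  qed
  have "cmod (g u0) \<le> cmod u0"
    by (rule Schwarz_Lemma(1)[OF ghol]) (use g1 u0 in \<open>auto simp: g_def M_def\<close>)
  then have "cmod (\<phi> z - \<phi> w) * cmod (1 - cnj w * z) \<le> cmod (z - w) * cmod (1 - cnj (\<phi> w) * \<phi> z)"
    using nz nz' unfolding g_def Mu0 by (simp add: u0_def norm_divide field_simps)
  then have "(cmod (\<phi> z - \<phi> w) * cmod (1 - cnj w * z))\<^sup>2 \<le> (cmod (z - w) * cmod (1 - cnj (\<phi> w) * \<phi> z))\<^sup>2"
    by (intro power_mono) auto
  then show ?thesis
    unfolding power_mult_distrib cmod_one_minus_cnj_mult[of w z] cmod_one_minus_cnj_mult[of "\<phi> w" "\<phi> z"]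
    by (simp add: algebra_simps)
qed

text \<open>Let \<open>w\<close> tend to \<open>1\<close> radially in the Schwarz--Pick inequality divided by \<open>1 - w\<close>.\<close>
lemma Julia_inequality:
  assumes \<phi>: "selfmap \<phi>" and z: "z \<in> unit_disc"
    and lim: "((\<lambda>x. (\<phi> (of_real x) - 1) / (of_real x - 1)) \<longlongrightarrow> of_real a) (at_left (1::real))"
  shows "(1 - (cmod z)\<^sup>2) * (cmod (1 - \<phi> z))\<^sup>2 \<le> a * ((1 - (cmod (\<phi> z))\<^sup>2) * (cmod (1 - z))\<^sup>2)"
proof -
  define q where "q x = (\<phi> (of_real x) - 1) / (of_real x - 1)" for x :: real
  have ev: "\<forall>\<^sub>F x in at_left (1::real). 0 < x \<and> x < 1"
    by (rule eventually_at_leftI[of 0]) auto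
  have \<phi>q: "\<phi> (of_real x) = 1 - of_real (1 - x) * q x" if "x < 1" for x
    using that by (simp add: q_def field_simps)
  have q: "(q \<longlongrightarrow> of_real a) (at_left 1)" using lim by (simp add: q_def[abs_def])
  have "((\<lambda>x. 1 - of_real (1 - x) * q x) \<longlongrightarrow> 1 - of_real (1 - 1) * of_real a) (at_left (1::real))"
    by (intro tendsto_intros q)
  then have "((\<lambda>x. 1 - of_real (1 - x) * q x) \<longlongrightarrow> 1) (at_left (1::real))"
    by simp
  moreover have "\<forall>\<^sub>F x in at_left 1. 1 - of_real (1 - x) * q x = \<phi> (of_real x)"
    by (rule eventually_mono[OF ev]) (simp only: \<phi>q)
  ultimately have \<phi>1: "((\<lambda>x. \<phi> (of_real x)) \<longlongrightarrow> 1) (at_left (1::real))"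
    by (rule Lim_transform_eventually)
  \<comment> \<open>\<open>l\<close> and \<open>m\<close> are the two sides of Schwarz-Pick with the
    common factor 1 - x removed; the difference quotient \<open>q\<close> survives in
    \<open>m\<close> and becomes \<open>a\<close> in the limit.\<close>
  define l where "l x = (1 - (cmod z)\<^sup>2) * (1 + x) * (cmod (1 - cnj (\<phi> (of_real x)) * \<phi> z))\<^sup>2" for x
  define m where "m x = (1 - (cmod (\<phi> z))\<^sup>2) * (2 * Re (q x) - (1 - x) * (cmod (q x))\<^sup>2) *
      (cmod (1 - of_real x * z))\<^sup>2" for x
  have "l x \<le> m x" if x: "0 < x" "x < 1" for x
  proof -
    have "1 - (cmod (\<phi> (of_real x)))\<^sup>2 = (1 - x) * (2 * Re (q x) - (1 - x) * (cmod (q x))\<^sup>2)"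
      unfolding \<phi>q[OF x(2)] cmod_power2 by (simp add: power2_eq_square algebra_simps)
    moreover have "1 - (cmod (of_real x :: complex))\<^sup>2 = (1 - x) * (1 + x)"
      using x by (simp add: power2_eq_square algebra_simps)
    ultimately have "(1 - x) * l x \<le> (1 - x) * m x"
      using Schwarz_Pick[OF \<phi> z, of "of_real x"] x by (simp add: l_def m_def mult_ac)
    then show ?thesis using x by simp
  qed
  then have "\<forall>\<^sub>F x in at_left 1. l x \<le> m x" using eventually_mono[OF ev] by fastforce
  moreover have "(l \<longlongrightarrow> (1 - (cmod z)\<^sup>2) * (1 + 1) * (cmod (1 - cnj 1 * \<phi> z))\<^sup>2) (at_left 1)"
    unfolding l_def by (intro tendsto_intros \<phi>1)
  moreover have "(m \<longlongrightarrow> (1 - (cmod (\<phi> z))\<^sup>2) * (2 * Re (of_real a) - (1 - 1) * (cmod (of_real a))\<^sup>2) *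
      (cmod (1 - of_real 1 * z))\<^sup>2) (at_left 1)"
    unfolding m_def by (intro tendsto_intros q)
  ultimately have "(1 - (cmod z)\<^sup>2) * (1 + 1) * (cmod (1 - cnj 1 * \<phi> z))\<^sup>2 \<le>
      (1 - (cmod (\<phi> z))\<^sup>2) * (2 * Re (of_real a) - (1 - 1) * (cmod (of_real a))\<^sup>2) *
      (cmod (1 - of_real 1 * z))\<^sup>2"
    by (intro tendsto_le[of "at_left 1" m _ l]) auto
  then show ?thesis by (simp add: algebra_simps)
qed

section \<open>Second-order Taylor expansion at a boundary point\<close>

lemma Lipschitz_imp_limit_within:
  fixes f :: "complex \<Rightarrow> complex"
  assumes "\<And>z w. z \<in> D \<Longrightarrow> w \<in> D \<Longrightarrow> cmod (f z - f w) \<le> K * cmod (z - w)" and "x \<in> closure D"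
  obtains l where "(f \<longlongrightarrow> l) (at x within D)"
proof -
  have "\<bar>K\<bar>-lipschitz_on D f"
  proof (rule lipschitz_onI)
    show "dist (f z) (f w) \<le> \<bar>K\<bar> * dist z w" if "z \<in> D" "w \<in> D" for z w
    proof -
      have "cmod (f z - f w) \<le> K * cmod (z - w)" by (rule assms(1)[OF that])
      also have "\<dots> \<le> \<bar>K\<bar> * cmod (z - w)" by (intro mult_right_mono) auto
      finally show ?thesis by (simp add: dist_norm)
    qed
  qed simp
  then have "uniformly_continuous_on D f" by (rule lipschitz_on_uniformly_continuous)
  then show ?thesis using uniformly_continuous_on_extension_at_closure assms(2) that by blast
qed

text \<open>The continuous extension bounds the third derivative near 1. On the convex set
  \<open>D\<close> the mean value inequality then descends: a bounded derivative makes the one below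
  Lipschitz, hence bounded again. Lipschitz functions have limits at 1, and a Lipschitz first
  derivative gives the quadratic remainder.\<close>

lemma boundary_Taylor_expansion:
  assumes \<phi>: "\<phi> holomorphic_on unit_disc"
    and g: "continuous_on (insert 1 unit_disc) g" "\<forall>z\<in>unit_disc. g z = (deriv ^^ 3) \<phi> z"
  obtains L l K \<rho> where "K \<ge> 0" "\<rho> > 0" "(deriv \<phi> \<longlongrightarrow> L) (at 1 within unit_disc)"
    "(\<phi> \<longlongrightarrow> l) (at 1 within unit_disc)"
    "\<And>z. z \<in> unit_disc \<Longrightarrow> cmod (z - 1) < \<rho> \<Longrightarrow> cmod (\<phi> z - l - L * (z - 1)) \<le> K * (cmod (z - 1))\<^sup>2"
proof -
  obtain \<rho> where \<rho>: "\<rho> > 0"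
    "\<And>z. z \<in> unit_disc \<Longrightarrow> dist z 1 < \<rho> \<Longrightarrow> dist (g z) (g 1) < 1"
    using g(1) unfolding continuous_on_iff by (metis insertCI zero_less_one)
  define D where "D = unit_disc \<inter> ball 1 \<rho>"
  have D: "open D" "convex D" "D \<subseteq> unit_disc"
    by (auto simp: D_def convex_Int)
  have at_D: "at 1 within D = at 1 within unit_disc"
    by (rule at_within_nhd[of _ "ball 1 \<rho>"]) (use \<rho> in \<open>auto simp: D_def\<close>)
  have nontriv: "at 1 within unit_disc \<noteq> (bot :: complex filter)"
    by (simp add: trivial_limit_within islimpt_ball)
  then have clD: "1 \<in> closure D"
    unfolding at_D[symmetric] trivial_limit_within by (simp add: closure_def)
  have Dne: "D \<noteq> {}" using clD by auto
  then obtain w0 where w0: "w0 \<in> D" by blast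
  have diam: "cmod (z - w) \<le> 2" if "z \<in> D" "w \<in> D" for z w
    using that norm_triangle_ineq4[of z w] by (auto simp: D_def)
  have der: "((deriv ^^ n) \<phi> has_field_derivative (deriv ^^ Suc n) \<phi> z) (at z within X)"
    if "z \<in> D" for n z X
  proof -
    have "(deriv ^^ n) \<phi> holomorphic_on unit_disc"
      by (rule holomorphic_higher_deriv[OF \<phi>]) simp
    then show ?thesis
      using that D(3) holomorphic_derivI[of "(deriv ^^ n) \<phi>" unit_disc z X] by auto
  qed
  have Lip: "\<exists>K\<ge>0. \<forall>z\<in>D. \<forall>w\<in>D. cmod ((deriv ^^ n) \<phi> z - (deriv ^^ n) \<phi> w) \<le> K * cmod (z - w)"
    if "\<And>z. z \<in> D \<Longrightarrow> cmod ((deriv ^^ Suc n) \<phi> z) \<le> K" for n K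
  proof (intro exI[of _ K] conjI ballI)
    show "0 \<le> K" using order_trans[OF norm_ge_zero that[OF w0]] .
    fix z w assume "z \<in> D" "w \<in> D"
    then show "cmod ((deriv ^^ n) \<phi> z - (deriv ^^ n) \<phi> w) \<le> K * cmod (z - w)"
      by (intro field_differentiable_bound[OF D(2) der that]) auto
  qed
  have bnd: "cmod ((deriv ^^ n) \<phi> z) \<le> cmod ((deriv ^^ n) \<phi> w0) + K * 2"
    if "K \<ge> 0" "\<forall>z\<in>D. \<forall>w\<in>D. cmod ((deriv ^^ n) \<phi> z - (deriv ^^ n) \<phi> w) \<le> K * cmod (z - w)"
      "z \<in> D" for n K z
  proof -
    have "cmod ((deriv ^^ n) \<phi> z) \<le> cmod ((deriv ^^ n) \<phi> w0) + cmod ((deriv ^^ n) \<phi> z - (deriv ^^ n) \<phi> w0)"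
      by (rule norm_triangle_sub)
    also have "cmod ((deriv ^^ n) \<phi> z - (deriv ^^ n) \<phi> w0) \<le> K * cmod (z - w0)"
      using that w0 by blast
    also have "\<dots> \<le> K * 2" using that diam[OF _ w0] by (intro mult_left_mono) auto
    finally show ?thesis by simp
  qed
  have "cmod ((deriv ^^ Suc 2) \<phi> z) \<le> cmod (g 1) + 1" if "z \<in> D" for z
  proof -
    have "z \<in> unit_disc" "dist z 1 < \<rho>" using that by (auto simp: D_def dist_commute)
    then have "cmod (g z - g 1) < 1" using \<rho>(2) by (simp add: dist_norm)
    then have "cmod (g z) \<le> cmod (g 1) + 1" using norm_triangle_sub[of "g z" "g 1"] by simp
    then show ?thesis using g(2) \<open>z \<in> unit_disc\<close> by (simp add: numeral_3_eq_3 numeral_2_eq_2)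
  qed
  from Lip[OF this] obtain K2 where K2: "K2 \<ge> 0"
    "\<forall>z\<in>D. \<forall>w\<in>D. cmod ((deriv ^^ 2) \<phi> z - (deriv ^^ 2) \<phi> w) \<le> K2 * cmod (z - w)" by blast
  have "cmod ((deriv ^^ Suc 1) \<phi> z) \<le> cmod ((deriv ^^ 2) \<phi> w0) + K2 * 2" if "z \<in> D" for z
    using bnd[OF K2 that] by (simp add: numeral_2_eq_2)
  from Lip[OF this] obtain K1 where K1: "K1 \<ge> 0"
    "\<forall>z\<in>D. \<forall>w\<in>D. cmod ((deriv ^^ 1) \<phi> z - (deriv ^^ 1) \<phi> w) \<le> K1 * cmod (z - w)" by blast
  have "cmod ((deriv ^^ Suc 0) \<phi> z) \<le> cmod ((deriv ^^ 1) \<phi> w0) + K1 * 2" if "z \<in> D" for z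
    using bnd[OF K1 that] by simp
  from Lip[OF this] obtain K0 where K0: "K0 \<ge> 0"
    "\<forall>z\<in>D. \<forall>w\<in>D. cmod ((deriv ^^ 0) \<phi> z - (deriv ^^ 0) \<phi> w) \<le> K0 * cmod (z - w)" by blast
  have K1': "cmod (deriv \<phi> z - deriv \<phi> w) \<le> K1 * cmod (z - w)" if "z \<in> D" "w \<in> D" for z w
    using K1 that by simp
  have K0': "cmod (\<phi> z - \<phi> w) \<le> K0 * cmod (z - w)" if "z \<in> D" "w \<in> D" for z w
    using K0 that by simp
  obtain L where L: "(deriv \<phi> \<longlongrightarrow> L) (at 1 within D)"
    using Lipschitz_imp_limit_within[OF K1' clD] by blast
  obtain l where l: "(\<phi> \<longlongrightarrow> l) (at 1 within D)"
    using Lipschitz_imp_limit_within[OF K0' clD] by blast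
  \<comment> \<open>The mean value inequality for \<phi>(u) - \<phi>'(w) u is applied on the part of
    \<open>D\<close> within |z - w| of \<open>w\<close>, where the derivative is at most K1 |z - w|.
    Expanding about interior points \<open>w\<close> lets the limit at 1 supply the boundary
    expansion.\<close>
  have quad: "cmod (\<phi> z - \<phi> w - deriv \<phi> w * (z - w)) \<le> K1 * cmod (z - w) * cmod (z - w)"
    if z: "z \<in> D" and w: "w \<in> D" for z w
  proof -
    have "cmod ((\<phi> z - deriv \<phi> w * z) - (\<phi> w - deriv \<phi> w * w)) \<le> K1 * cmod (z - w) * cmod (z - w)"
    proof (rule field_differentiable_bound[where S = "D \<inter> cball w (cmod (z - w))"
          and f = "\<lambda>u. \<phi> u - deriv \<phi> w * u" and f' = "\<lambda>u. deriv \<phi> u - deriv \<phi> w"])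
      show "convex (D \<inter> cball w (cmod (z - w)))" using D by (intro convex_Int) auto
      fix u assume u: "u \<in> D \<inter> cball w (cmod (z - w))"
      then have "(\<phi> has_field_derivative deriv \<phi> u) (at u within D \<inter> cball w (cmod (z - w)))"
        using der[of u 0] by simp
      then show "((\<lambda>u. \<phi> u - deriv \<phi> w * u) has_field_derivative deriv \<phi> u - deriv \<phi> w)
          (at u within D \<inter> cball w (cmod (z - w)))"
        by (auto intro!: derivative_eq_intros)
      have "cmod (deriv \<phi> u - deriv \<phi> w) \<le> K1 * cmod (u - w)" using K1' u w by blast
      also have "\<dots> \<le> K1 * cmod (z - w)"
        using u K1 by (intro mult_left_mono) (auto simp: dist_norm norm_minus_commute)
      finally show "cmod (deriv \<phi> u - deriv \<phi> w) \<le> K1 * cmod (z - w)" .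
    qed (use z w in \<open>auto simp: dist_norm norm_minus_commute\<close>)
    then show ?thesis by (simp add: algebra_simps)
  qed
  show thesis
  proof
    show "K1 \<ge> 0" "\<rho> > 0" by fact+
    show "(deriv \<phi> \<longlongrightarrow> L) (at 1 within unit_disc)" using L by (simp add: at_D)
    show "(\<phi> \<longlongrightarrow> l) (at 1 within unit_disc)" using l by (simp add: at_D)
    fix z assume z: "z \<in> unit_disc" "cmod (z - 1) < \<rho>"
    then have zD: "z \<in> D" by (simp add: D_def dist_norm norm_minus_commute)
    have "cmod (\<phi> z - l - L * (z - 1)) \<le> K1 * cmod (z - 1) * cmod (z - 1)"
    proof (rule tendsto_le)
      show "at 1 within D \<noteq> bot" using nontriv by (simp add: at_D)
      show "((\<lambda>w. cmod (\<phi> z - \<phi> w - deriv \<phi> w * (z - w))) \<longlongrightarrow> cmod (\<phi> z - l - L * (z - 1))) (at 1 within D)"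
        by (intro tendsto_intros l L)
      show "((\<lambda>w. K1 * cmod (z - w) * cmod (z - w)) \<longlongrightarrow> K1 * cmod (z - 1) * cmod (z - 1)) (at 1 within D)"
        by (intro tendsto_intros)
      show "\<forall>\<^sub>F w in at 1 within D. cmod (\<phi> z - \<phi> w - deriv \<phi> w * (z - w)) \<le> K1 * cmod (z - w) * cmod (z - w)"
        using quad[OF zD] by (auto simp: eventually_at_filter)
    qed
    then show "cmod (\<phi> z - l - L * (z - 1)) \<le> K1 * (cmod (z - 1))\<^sup>2"
      by (simp add: power2_eq_square mult.assoc)
  qed
qed

section \<open>The half-plane coordinate and the data extracted from the symbol\<close>

definition cayley :: "complex \<Rightarrow> complex" where
  "cayley z = (1 + z) / (1 - z)"

text \<open>This is the Poisson kernel at 1, whose superlevel sets are the horodiscs tangent at 1.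
  Julia's inequality and the tangent subdisc thereby become lower bounds on real parts.\<close>

lemma Re_cayley: "Re (cayley z) = (1 - (cmod z)\<^sup>2) / (cmod (1 - z))\<^sup>2"
  unfolding cayley_def Re_divide cmod_power2 by (simp add: power2_eq_square algebra_simps)

lemma Re_cayley_pos: "z \<in> unit_disc \<Longrightarrow> 0 < Re (cayley z)"
  unfolding Re_cayley by (intro divide_pos_pos) (auto simp: power_less_one_iff)

text \<open>The spectral analysis depends on \<phi> only through these estimates: an expansion at
  the fixed point with multiplier \<open>a\<close>, Julia's inequality, and the tangent subdisc seen
  as the half-plane to the right of \<delta>.\<close>

locale hyperbolic_model =
  fixes \<phi> :: "complex \<Rightarrow> complex" and a K \<rho> \<delta> :: real
  assumes selfmap: "selfmap \<phi>"
    and a: "0 < a" "a < 1"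
    and K: "0 \<le> K" and \<rho>: "0 < \<rho>" and \<delta>: "0 < \<delta>"
    and Taylor: "\<And>z. z \<in> unit_disc \<Longrightarrow> cmod (z - 1) < \<rho> \<Longrightarrow>
      cmod (\<phi> z - 1 - of_real a * (z - 1)) \<le> K * (cmod (z - 1))\<^sup>2"
    and Julia: "\<And>z. z \<in> unit_disc \<Longrightarrow> Re (cayley z) \<le> a * Re (cayley (\<phi> z))"
    and horodisc: "\<And>z. z \<in> unit_disc \<Longrightarrow> \<delta> \<le> Re (cayley (\<phi> z))"

lemma elf_hyperbolic_imp_model:
  assumes "essentially_linear_fractional \<phi>" "hyperbolic_type \<phi>" "denjoy_wolff_point \<phi> 1"
  obtains a K \<rho> \<delta> where "hyperbolic_model \<phi> a K \<rho> \<delta>" "boundary_value (deriv \<phi>) 1 = of_real a"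
proof -
  have \<phi>: "selfmap \<phi>" using assms(1) by (simp add: essentially_linear_fractional_def)
  define p where "p n = (\<phi> ^^ n) 0" for n
  have p1: "p \<longlonglongrightarrow> 1"
    using assms(3) by (auto simp: denjoy_wolff_point_def p_def[abs_def])
  have pS: "p (Suc n) = \<phi> (p n)" for n by (simp add: p_def)
  have pU: "p n \<in> unit_disc" for n
    by (induction n) (use selfmap_in_disc[OF \<phi>] in \<open>auto simp: p_def\<close>)
  have p1': "(\<lambda>n. \<phi> (p n)) \<longlonglongrightarrow> 1"
    using LIMSEQ_Suc[OF p1] by (simp add: pS)
  obtain \<eta> r \<zeta>0 g where \<eta>: "\<eta> \<in> sphere 0 1" and r: "0 < r" "r < 1"
    and sub: "\<phi> ` unit_disc \<subseteq> ball (complex_of_real (1 - r) * \<eta>) r"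
    and \<zeta>0: "boundary_preimage \<phi> \<eta> = {\<zeta>0}"
    and g: "continuous_on (insert \<zeta>0 unit_disc) g" "\<forall>z\<in>unit_disc. g z = (deriv ^^ 3) \<phi> z"
    using assms(1) unfolding essentially_linear_fractional_def by blast
  \<comment> \<open>After one step the orbit of 0 stays in the subdisc, and it tends to 1; the
    closed subdisc meets the unit circle only at \<eta>.\<close>
  have "\<eta> = 1"
  proof -
    have "\<phi> (p n) \<in> cball (complex_of_real (1 - r) * \<eta>) r" for n
      using sub pU[of n] ball_subset_cball by blast
    then have "1 \<in> cball (complex_of_real (1 - r) * \<eta>) r"
      by (rule closed_sequentially[OF closed_cball _ p1'])
    then have "(cmod (complex_of_real (1 - r) * \<eta> - 1))\<^sup>2 \<le> r\<^sup>2"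
      by (intro power_mono) (auto simp: dist_norm)
    moreover have \<eta>2: "(Re \<eta>)\<^sup>2 + (Im \<eta>)\<^sup>2 = 1"
      using \<eta> by (simp flip: cmod_power2)
    moreover have "(cmod (complex_of_real (1 - r) * \<eta> - 1))\<^sup>2
        = (1 - r)\<^sup>2 * ((Re \<eta>)\<^sup>2 + (Im \<eta>)\<^sup>2) - 2 * (1 - r) * Re \<eta> + 1"
      unfolding cmod_power2 by (simp add: power2_eq_square algebra_simps)
    ultimately have "(1 - r) * (2 - 2 * Re \<eta>) \<le> 0"
      by (simp add: power2_eq_square algebra_simps)
    then have "1 \<le> Re \<eta>" using r by (simp add: mult_le_0_iff)
    moreover have "Re \<eta> \<le> 1" using complex_Re_le_cmod[of \<eta>] \<eta> by simp
    ultimately show ?thesis using \<eta>2 by (simp add: complex_eq_iff)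
  qed
  \<comment> \<open>The orbit of 0 is the witness: it tends to 1, and so does its image, the shifted
    orbit.\<close>
  have "1 \<in> boundary_preimage \<phi> \<eta>"
    unfolding boundary_preimage_def cluster_set_def \<open>\<eta> = 1\<close> using pU p1 p1' by auto
  then have "\<zeta>0 = 1" using \<zeta>0 by auto
  have hol: "\<phi> holomorphic_on unit_disc" using \<phi> by (simp add: selfmap_def)
  obtain L l K \<rho> where K: "K \<ge> 0" "\<rho> > 0" and L: "(deriv \<phi> \<longlongrightarrow> L) (at 1 within unit_disc)"
    and l: "(\<phi> \<longlongrightarrow> l) (at 1 within unit_disc)"
    and Tay: "\<And>z. z \<in> unit_disc \<Longrightarrow> cmod (z - 1) < \<rho> \<Longrightarrow> cmod (\<phi> z - l - L * (z - 1)) \<le> K * (cmod (z - 1))\<^sup>2"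
    by (rule boundary_Taylor_expansion[OF hol g[unfolded \<open>\<zeta>0 = 1\<close>]]) (rule that)
  have nontriv: "at 1 within unit_disc \<noteq> (bot :: complex filter)"
    by (simp add: trivial_limit_within islimpt_ball)
  have pn1: "p n \<noteq> 1" for n using pU[of n] by auto
  have "filterlim p (at 1 within unit_disc) sequentially"
    unfolding filterlim_at using p1 pU pn1 by auto
  then have "(\<lambda>n. \<phi> (p n)) \<longlonglongrightarrow> l" by (rule filterlim_compose[OF l])
  then have l1: "l = 1" using LIMSEQ_unique p1' by blast
  obtain \<omega> \<eta>' d where \<omega>: "denjoy_wolff_point \<phi> \<omega>"
    and ang: "has_angular_limit \<phi> \<omega> \<eta>'"
      "has_angular_limit (\<lambda>z. (\<phi> z - \<eta>') / (z - \<omega>)) \<omega> (complex_of_real d)" and d: "d < 1"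
    using assms(2) unfolding hyperbolic_type_def has_angular_derivative_def by blast
  have "p \<longlonglongrightarrow> \<omega>" using \<omega> by (auto simp: denjoy_wolff_point_def p_def[abs_def])
  then have "\<omega> = 1" using LIMSEQ_unique p1 by blast
  \<comment> \<open>The Stolz region of aperture 2 contains the radius, on which |x - 1| = 1 - x.
    Along the radius the angular limits can be compared with those of the Taylor expansion, which
    identifies \<eta>' with 1 and \<open>L\<close> with \<open>d\<close>.\<close>
  define St where "St = {z \<in> unit_disc. cmod (z - 1) < 2 * (1 - cmod z)}"
  have radial: "filterlim of_real (at 1 within St) (at_left (1::real))"
  proof -
    have "(of_real \<longlongrightarrow> (of_real 1 :: complex)) (at_left (1::real))" by (intro tendsto_intros)
    moreover have "\<forall>\<^sub>F x in at_left (1::real). (of_real x :: complex) \<in> St - {1}"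
    proof (rule eventually_at_leftI[of 0])
      fix x :: real assume x: "x \<in> {0<..<1}"
      have "cmod (of_real x - 1) = 1 - x"
        using x norm_of_real[of "x - 1", where 'a = complex] by (simp del: norm_of_real)
      then show "(of_real x :: complex) \<in> St - {1}" using x by (auto simp: St_def)
    qed simp
    ultimately show ?thesis unfolding filterlim_at by (simp add: eventually_conj_iff)
  qed
  have St2: "(f \<longlongrightarrow> b) (at 1 within St)" if "has_angular_limit f 1 b" for f b
    using that unfolding has_angular_limit_def St_def by (metis one_less_numeral_iff semiring_norm(76))
  have radU: "filterlim of_real (at 1 within unit_disc) (at_left (1::real))"
    by (rule filterlim_mono[OF radial]) (auto simp: St_def intro: at_le)
  have "((\<lambda>x. \<phi> (of_real x)) \<longlongrightarrow> \<eta>') (at_left (1::real))"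
    using filterlim_compose[OF St2 radial] ang(1) \<open>\<omega> = 1\<close> by blast
  moreover have "((\<lambda>x. \<phi> (of_real x)) \<longlongrightarrow> 1) (at_left (1::real))"
    using filterlim_compose[OF l radU] l1 by simp
  ultimately have "\<eta>' = 1" using tendsto_unique[OF trivial_limit_at_left_real] by blast
  then have quot: "((\<lambda>x. (\<phi> (of_real x) - 1) / (of_real x - 1)) \<longlongrightarrow> of_real d) (at_left (1::real))"
    using filterlim_compose[OF St2 radial] ang(2) \<open>\<omega> = 1\<close> by blast
  have "((\<lambda>x. (\<phi> (of_real x) - 1) / (of_real x - 1) - L) \<longlongrightarrow> 0) (at_left (1::real))"
  proof (rule Lim_null_comparison)
    have "((\<lambda>x. K * (1 - x)) \<longlongrightarrow> K * (1 - 1)) (at_left (1::real))" by (intro tendsto_intros)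
    then show "((\<lambda>x. K * (1 - x)) \<longlongrightarrow> 0) (at_left (1::real))" by simp
    show "\<forall>\<^sub>F x in at_left 1. cmod ((\<phi> (of_real x) - 1) / (of_real x - 1) - L) \<le> K * (1 - x)"
    proof (rule eventually_at_leftI[of "max 0 (1 - \<rho>)"])
      fix x :: real assume x: "x \<in> {max 0 (1 - \<rho>)<..<1}"
      have c: "cmod (of_real x - 1) = 1 - x"
        using x norm_of_real[of "x - 1", where 'a = complex] by (simp del: norm_of_real)
      have "cmod (\<phi> (of_real x) - 1 - L * (of_real x - 1)) \<le> K * (1 - x)\<^sup>2"
        using Tay[of "of_real x"] x c by (simp add: l1)
      moreover have "(\<phi> (of_real x) - 1) / (of_real x - 1) - L
          = (\<phi> (of_real x) - 1 - L * (of_real x - 1)) / (of_real x - 1)"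
        using x by (simp add: field_simps)
      ultimately show "cmod ((\<phi> (of_real x) - 1) / (of_real x - 1) - L) \<le> K * (1 - x)"
        using x by (simp add: norm_divide c power2_eq_square field_simps)
    qed (use K in simp)
  qed
  then have "((\<lambda>x. (\<phi> (of_real x) - 1) / (of_real x - 1)) \<longlongrightarrow> L) (at_left (1::real))"
    using Lim_null by blast
  then have Ld: "L = of_real d" using quot tendsto_unique[OF trivial_limit_at_left_real] by blast
  have jul: "Re (cayley z) \<le> d * Re (cayley (\<phi> z))" if z: "z \<in> unit_disc" for z
  proof -
    have "z \<noteq> 1" "\<phi> z \<noteq> 1" using z selfmap_in_disc[OF \<phi> z] by auto
    then show ?thesis
      using Julia_inequality[OF \<phi> z quot] unfolding Re_cayley by (simp add: field_simps)
  qed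
  \<comment> \<open>Positivity of \<open>d\<close> comes from Julia's inequality at 0, where
    \<open>cayley\<close> equals 1.\<close>
  have "0 < d * Re (cayley (\<phi> 0))" using jul[of 0] by (simp add: cayley_def)
  then have d0: "0 < d"
    using Re_cayley_pos[OF selfmap_in_disc[OF \<phi>], of 0] by (simp add: zero_less_mult_iff)
  \<comment> \<open>The circle of radius \<open>r\<close> about 1 - r is, apart from 1, the
    horocycle on which \<open>Re (cayley w)\<close> equals (1 - r) / r.\<close>
  have horo: "(1 - r) / r \<le> Re (cayley (\<phi> z))" if z: "z \<in> unit_disc" for z
  proof -
    have ne: "\<phi> z \<noteq> 1" using selfmap_in_disc[OF \<phi> z] by auto
    have "\<phi> z \<in> ball (complex_of_real (1 - r)) r" using sub z unfolding \<open>\<eta> = 1\<close> mult_1_right by blast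
    then have "(cmod (complex_of_real (1 - r) - \<phi> z))\<^sup>2 \<le> r\<^sup>2"
      by (intro power_mono) (auto simp: dist_norm)
    then have "(1 - r) * (cmod (1 - \<phi> z))\<^sup>2 \<le> r * (1 - (cmod (\<phi> z))\<^sup>2)"
      unfolding cmod_power2 by (simp add: power2_eq_square algebra_simps)
    then show ?thesis unfolding Re_cayley using r ne by (simp add: field_simps)
  qed
  show thesis
  proof
    show "hyperbolic_model \<phi> d K \<rho> ((1 - r) / r)"
      using \<phi> d d0 K Tay jul horo r by unfold_locales (auto simp: l1 Ld)
    show "boundary_value (deriv \<phi>) 1 = of_real d"
      unfolding boundary_value_def using tendsto_Lim[OF nontriv L] Ld by simp
  qed
qed


section \<open>Linearization and eigenfunctions\<close>

lemma cayley_holomorphic: "cayley holomorphic_on unit_disc"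
  unfolding cayley_def[abs_def] by (intro holomorphic_intros) auto

context hyperbolic_model
begin

lemma iter_in_disc: "z \<in> unit_disc \<Longrightarrow> (\<phi> ^^ n) z \<in> unit_disc"
  by (rule selfmap_in_disc[OF selfmap_funpow[OF selfmap]])

lemma Re_cayley_iter:
  assumes "z \<in> unit_disc"
  shows "Re (cayley z) \<le> a ^ n * Re (cayley ((\<phi> ^^ n) z))"
proof (induction n)
  case (Suc n)
  have "a ^ n * Re (cayley ((\<phi> ^^ n) z)) \<le> a ^ n * (a * Re (cayley (\<phi> ((\<phi> ^^ n) z))))"
    using a by (intro mult_left_mono Julia iter_in_disc assms) auto
  then show ?case using Suc by (simp add: mult_ac)
qed simp

text \<open>With u = 1 - z one has cayley z = 2 / u - 1 and 1 - \<phi>(z) = a u + e, where |e| is at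
  most K |u|^2. The difference of the two reciprocals has a quadratically small numerator over a
  denominator of order |u|^2, so it stays bounded.\<close>

lemma cmod_cayley_step:
  obtains M \<rho>' where "0 < M" "0 < \<rho>'"
    "\<And>z. z \<in> unit_disc \<Longrightarrow> cmod (z - 1) < \<rho>' \<Longrightarrow> cmod (cayley (\<phi> z) - cayley z / of_real a) \<le> M"
proof
  \<comment> \<open>The second radius forces K |u| \<le> a / 2, hence |1 - \<phi>(z)| \<ge> a |u| /
    2; \<open>K + 1\<close> covers the case K = 0.\<close>
  define \<rho>' where "\<rho>' = min \<rho> (a / (2 * (K + 1)))"
  show "0 < 4 * K / a\<^sup>2 + 1 + 1 / a" using a K by (intro add_nonneg_pos) auto
  show "0 < \<rho>'" using a K \<rho> by (simp add: \<rho>'_def)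
  fix z assume z: "z \<in> unit_disc" "cmod (z - 1) < \<rho>'"
  define u where "u = 1 - z"
  define e where "e = 1 - \<phi> z - of_real a * u"
  have u0: "u \<noteq> 0" "cmod u = cmod (z - 1)" using z by (auto simp: u_def norm_minus_commute)
  have p0: "1 - \<phi> z \<noteq> 0" using selfmap_in_disc[OF selfmap z(1)] by auto
  have a0: "complex_of_real a \<noteq> 0" using a by simp
  have "e = - (\<phi> z - 1 - of_real a * (z - 1))" by (simp add: e_def u_def algebra_simps)
  then have "cmod e = cmod (\<phi> z - 1 - of_real a * (z - 1))" by (simp only: norm_minus_cancel)
  then have e: "cmod e \<le> K * (cmod u)\<^sup>2"
    using Taylor[of z] z u0 by (simp add: \<rho>'_def)
  have "K * cmod u \<le> (K + 1) * cmod u" by (simp add: mult_right_mono)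
  also have "\<dots> \<le> (K + 1) * (a / (2 * (K + 1)))"
    using z u0 K by (intro mult_left_mono) (auto simp: \<rho>'_def)
  also have "\<dots> = a / 2" using K by (simp add: field_simps)
  finally have "K * cmod u \<le> a / 2" .
  then have "K * (cmod u)\<^sup>2 \<le> a / 2 * cmod u"
    using mult_right_mono[of "K * cmod u" "a / 2" "cmod u"] by (simp add: power2_eq_square mult.assoc)
  moreover have "cmod (1 - \<phi> z) \<ge> cmod (of_real a * u) - cmod e"
    using norm_triangle_ineq4[of "1 - \<phi> z" e] by (simp add: e_def)
  ultimately have low: "a / 2 * cmod u \<le> cmod (1 - \<phi> z)"
    using e a by (simp add: norm_mult)
  have "cayley (\<phi> z) - cayley z / of_real a = - (2 * e / (of_real a * u * (1 - \<phi> z))) - 1 + 1 / of_real a"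
  proof -
    have "cayley (\<phi> z) = 2 / (1 - \<phi> z) - 1" "cayley z = 2 / u - 1"
      using p0 u0 by (simp_all add: cayley_def u_def field_simps)
    moreover have "(2 / v - 1) - (2 / u - 1) / b = - (2 * (v - b * u) / (b * u * v)) - 1 + 1 / b"
      if "u \<noteq> 0" "v \<noteq> 0" "b \<noteq> 0" for u v b :: complex
      using that by (simp add: field_simps)
    ultimately show ?thesis using p0 u0 a0 by (simp add: e_def)
  qed
  also have "cmod \<dots> \<le> cmod (2 * e / (of_real a * u * (1 - \<phi> z))) + 1 + 1 / a"
  proof -
    have "cmod (1 / complex_of_real a) = 1 / a" using a by (simp add: norm_divide)
    then show ?thesis
      using norm_triangle_ineq[of "- (2 * e / (of_real a * u * (1 - \<phi> z))) - 1" "1 / of_real a"]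
        norm_triangle_ineq4[of "- (2 * e / (of_real a * u * (1 - \<phi> z)))" 1] by simp
  qed
  also have "cmod (2 * e / (of_real a * u * (1 - \<phi> z))) \<le> 4 * K / a\<^sup>2"
  proof -
    have "cmod (2 * e / (of_real a * u * (1 - \<phi> z))) = 2 * cmod e / (a * cmod u * cmod (1 - \<phi> z))"
      using a by (simp add: norm_divide norm_mult)
    also have "\<dots> \<le> 2 * (K * (cmod u)\<^sup>2) / (a * cmod u * (a / 2 * cmod u))"
      using e low a u0 K by (intro frac_le mult_left_mono mult_pos_pos mult_nonneg_nonneg) auto
    also have "\<dots> = 4 * K / a\<^sup>2"
    proof -
      have "cmod u \<noteq> 0" using u0(1) by simp
      then show ?thesis using a by (simp add: power2_eq_square field_simps)
    qed
    finally show ?thesis .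
  qed
  finally show "cmod (cayley (\<phi> z) - cayley z / of_real a) \<le> 4 * K / a\<^sup>2 + 1 + 1 / a" by simp
qed

section \<open>The linearizing map\<close>

definition rescaled :: "nat \<Rightarrow> complex \<Rightarrow> complex" where
  "rescaled n z = of_real (a ^ n) * cayley ((\<phi> ^^ n) z)"

text \<open>This is \<sigma>, Valiron's half-plane analogue of the Koenigs function; convergence,
  and with it the meaning of \<open>lim\<close>, is established on the disc.\<close>

definition linearizer :: "complex \<Rightarrow> complex" where
  "linearizer z = lim (\<lambda>n. rescaled n z)"

lemma Re_rescaled_ge: "z \<in> unit_disc \<Longrightarrow> Re (cayley z) \<le> Re (rescaled n z)"
  using Re_cayley_iter by (simp add: rescaled_def)

lemma rescaled_holomorphic: "rescaled n holomorphic_on unit_disc"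
proof -
  have "(cayley \<circ> (\<phi> ^^ n)) holomorphic_on unit_disc"
    using selfmap_funpow[OF selfmap, of n] unfolding selfmap_def
    by (intro holomorphic_on_compose_gen[OF _ cayley_holomorphic]) auto
  then have "(\<lambda>z. cayley ((\<phi> ^^ n) z)) holomorphic_on unit_disc" by (simp add: o_def)
  then show ?thesis unfolding rescaled_def[abs_def] by (intro holomorphic_intros)
qed

text \<open>A lower bound on \<open>Re (cayley z)\<close> lets Julia's inequality drive all iterates
  w into the Taylor neighbourhood at the uniform rate |1 - w| \<le> 2 a^n / \<epsilon>. From then on
  consecutive rescaled iterates differ by at most M a^n, and the Weierstrass test applies.\<close>

lemma rescaled_uniform_limit:
  assumes A: "A \<subseteq> unit_disc" and \<epsilon>: "\<epsilon> > 0" "\<And>z. z \<in> A \<Longrightarrow> \<epsilon> \<le> Re (cayley z)"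
  shows "uniform_limit A rescaled linearizer sequentially"
proof -
  obtain M \<rho>' where M: "0 < M" "0 < \<rho>'"
    "\<And>z. z \<in> unit_disc \<Longrightarrow> cmod (z - 1) < \<rho>' \<Longrightarrow> cmod (cayley (\<phi> z) - cayley z / of_real a) \<le> M"
    using cmod_cayley_step by blast
  have "(\<lambda>n. 2 * a ^ n / \<epsilon>) \<longlonglongrightarrow> 2 * 0 / \<epsilon>"
    using a \<epsilon> by (intro tendsto_intros LIMSEQ_power_zero) auto
  then have ev: "\<forall>\<^sub>F n in sequentially. 2 * a ^ n / \<epsilon> < \<rho>'"
    using M(2) by (intro order_tendstoD) auto
  define f where "f n z = rescaled (Suc n) z - rescaled n z" for n z
  have bound: "cmod (f n z) \<le> M * a ^ n" if n: "2 * a ^ n / \<epsilon> < \<rho>'" and z: "z \<in> A" for n z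
  proof -
    define w where "w = (\<phi> ^^ n) z"
    have zU: "z \<in> unit_disc" using z A by blast
    have w: "w \<in> unit_disc" unfolding w_def by (rule iter_in_disc[OF zU])
    have "\<epsilon> \<le> a ^ n * Re (cayley w)"
      using \<epsilon>(2)[OF z] Re_cayley_iter[OF zU, of n] by (simp add: w_def)
    then have lower: "\<epsilon> / a ^ n \<le> Re (cayley w)" using a by (simp add: field_simps)
    have "1 - w \<noteq> 0" using w by auto
    then have "cayley w + 1 = 2 / (1 - w)" by (simp add: cayley_def field_simps)
    then have "cmod (1 - w) * cmod (cayley w + 1) = 2" using w by (auto simp: norm_divide)
    moreover have "\<epsilon> / a ^ n \<le> cmod (cayley w + 1)"
      using lower complex_Re_le_cmod[of "cayley w + 1"] by simp
    ultimately have "cmod (1 - w) * (\<epsilon> / a ^ n) \<le> 2"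
      by (metis mult_left_mono norm_ge_zero)
    then have "cmod (w - 1) \<le> 2 * a ^ n / \<epsilon>"
      using \<epsilon> a by (simp add: field_simps norm_minus_commute)
    then have "cmod (cayley (\<phi> w) - cayley w / of_real a) \<le> M" using M(3)[OF w] n by simp
    then have "a ^ Suc n * cmod (cayley (\<phi> w) - cayley w / of_real a) \<le> a ^ Suc n * M"
      using a by (intro mult_left_mono) auto
    moreover have "f n z = of_real (a ^ Suc n) * (cayley (\<phi> w) - cayley w / of_real a)"
      using a by (simp add: f_def rescaled_def w_def field_simps)
    ultimately have "cmod (f n z) \<le> a ^ Suc n * M"
      using a by (simp add: norm_mult norm_power)
    also have "\<dots> \<le> M * a ^ n" using a M by (simp add: mult_left_le_one_le)
    finally show ?thesis .
  qed
  have "\<forall>\<^sub>F n in sequentially. \<forall>z\<in>A. cmod (f n z) \<le> M * a ^ n"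
    by (rule eventually_mono[OF ev]) (use bound in blast)
  moreover have "summable (\<lambda>n. M * a ^ n)"
    using a by (intro summable_mult summable_geometric) auto
  ultimately have "uniform_limit A (\<lambda>n z. \<Sum>i<n. f i z) (\<lambda>z. \<Sum>i. f i z) sequentially"
    by (rule Weierstrass_m_test_ev)
  then have "uniform_limit A (\<lambda>n z. rescaled 0 z + (\<Sum>i<n. f i z)) (\<lambda>z. rescaled 0 z + (\<Sum>i. f i z)) sequentially"
    by (intro uniform_limit_intros)
  moreover have "rescaled 0 z + (\<Sum>i<n. f i z) = rescaled n z" for n z
    using sum_lessThan_telescope[of "\<lambda>i. rescaled i z" n] by (simp add: f_def)
  ultimately have ul: "uniform_limit A rescaled (\<lambda>z. rescaled 0 z + (\<Sum>i. f i z)) sequentially"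
    by simp
  have "rescaled 0 z + (\<Sum>i. f i z) = linearizer z" if "z \<in> A" for z
    unfolding linearizer_def by (rule limI[OF tendsto_uniform_limitI[OF ul that], symmetric])
  then show ?thesis
    using uniform_limit_cong'[of A rescaled rescaled "\<lambda>z. rescaled 0 z + (\<Sum>i. f i z)" linearizer] ul by auto
qed

lemma rescaled_tendsto: "z \<in> unit_disc \<Longrightarrow> (\<lambda>n. rescaled n z) \<longlonglongrightarrow> linearizer z"
  using tendsto_uniform_limitI[OF rescaled_uniform_limit[of "{z}" "Re (cayley z)"], of z] Re_cayley_pos[of z]
  by auto

lemma linearizer_holomorphic: "linearizer holomorphic_on unit_disc"
proof (rule holomorphic_uniform_sequence[OF _ rescaled_holomorphic])
  fix z :: complex assume z: "z \<in> unit_disc"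
  obtain d where d: "d > 0" "cball z d \<subseteq> unit_disc"
    using open_contains_cball_eq[OF open_ball] z by blast
  have "continuous_on (cball z d) (\<lambda>z. Re (cayley z))"
    using holomorphic_on_imp_continuous_on[OF holomorphic_on_subset[OF cayley_holomorphic d(2)]]
    by (intro continuous_intros)
  then obtain w where w: "w \<in> cball z d" "\<And>v. v \<in> cball z d \<Longrightarrow> Re (cayley w) \<le> Re (cayley v)"
    using continuous_attains_inf[of "cball z d" "\<lambda>z. Re (cayley z)"] d by auto
  have "uniform_limit (cball z d) rescaled linearizer sequentially"
    by (rule rescaled_uniform_limit[OF d(2) Re_cayley_pos w(2)]) (use w d in auto)
  then show "\<exists>d>0. cball z d \<subseteq> unit_disc \<and> uniform_limit (cball z d) rescaled linearizer sequentially"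
    using d by blast
qed simp

lemma linearizer_comp:
  assumes z: "z \<in> unit_disc"
  shows "linearizer (\<phi> z) = of_real (1 / a) * linearizer z"
proof -
  have "rescaled n (\<phi> z) = of_real (1 / a) * rescaled (Suc n) z" for n
    using a by (simp add: rescaled_def funpow_swap1)
  then have "(\<lambda>n. rescaled n (\<phi> z)) \<longlonglongrightarrow> of_real (1 / a) * linearizer z"
    using tendsto_mult_left[OF LIMSEQ_Suc[OF rescaled_tendsto[OF z]], of "of_real (1 / a)"] by simp
  then show ?thesis
    using LIMSEQ_unique[OF rescaled_tendsto[OF selfmap_in_disc[OF selfmap z]]] by blast
qed

text \<open>The subdisc constrains \<phi>(z) rather than \<open>z\<close>, so the estimate starts
  one step later; this is the origin of the factor \<open>a\<close>.\<close>

lemma Re_linearizer_ge: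
  assumes z: "z \<in> unit_disc"
  shows "a * \<delta> \<le> Re (linearizer z)"
proof (rule tendsto_lowerbound)
  show "(\<lambda>n. Re (rescaled (Suc n) z)) \<longlonglongrightarrow> Re (linearizer z)"
    by (intro tendsto_Re LIMSEQ_Suc rescaled_tendsto z)
  have "a * \<delta> \<le> Re (rescaled (Suc n) z)" for n
  proof -
    have "a * \<delta> \<le> a * Re (cayley (\<phi> z))" using a horodisc[OF z] by simp
    also have "\<dots> \<le> a * Re (rescaled n (\<phi> z))"
      using a Re_rescaled_ge[OF selfmap_in_disc[OF selfmap z]] by (intro mult_left_mono) auto
    also have "\<dots> = Re (rescaled (Suc n) z)" by (simp add: rescaled_def funpow_swap1)
    finally show ?thesis .
  qed
  then show "\<forall>\<^sub>F n in sequentially. a * \<delta> \<le> Re (rescaled (Suc n) z)" by simp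
qed simp

lemma Re_linearizer_pos: "z \<in> unit_disc \<Longrightarrow> 0 < Re (linearizer z)"
  using Re_linearizer_ge[of z] a \<delta> mult_pos_pos[of a \<delta>] by linarith

section \<open>Growth of the powers and the upper bound for the spectrum\<close>

lemma norm_comp_op_funpow_le:
  obtains C where "\<And>n f. norm ((comp_op \<phi> ^^ n) f) \<le> C * (a powr (- 1 / 2)) ^ n * norm f"
proof -
  have "Bseq (\<lambda>n. rescaled n 0)"
    using rescaled_tendsto[of 0] by (intro convergent_imp_Bseq) (auto simp: convergent_def)
  then obtain B where B: "B > 0" "\<And>n. cmod (rescaled n 0) \<le> B" by (auto elim: BseqE)
  have "norm ((comp_op \<phi> ^^ n) f) \<le> (B + 1) * (a powr (- 1 / 2)) ^ n * norm f" for n f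
  proof -
    define p where "p = (\<phi> ^^ n) 0"
    have p: "p \<in> unit_disc" unfolding p_def by (rule iter_in_disc) simp
    have an: "0 < a ^ n" "a ^ n \<le> 1" using a by (auto intro: power_le_one)
    have h: "1 \<le> a ^ n * Re (cayley p)"
      using Re_cayley_iter[of 0 n] by (simp add: p_def cayley_def)
    have "a ^ n * cmod (cayley p) \<le> B"
      using B(2)[of n] a by (simp add: rescaled_def p_def norm_mult norm_power)
    moreover have "cmod (cayley p + 1) \<le> cmod (cayley p) + 1"
      using norm_triangle_ineq[of "cayley p" 1] by simp
    then have "a ^ n * cmod (cayley p + 1) \<le> a ^ n * (cmod (cayley p) + 1)"
      using an by (intro mult_left_mono) auto
    ultimately have c1: "a ^ n * cmod (cayley p + 1) \<le> B + 1"
      using an by (simp add: algebra_simps)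
    have p1: "1 - p \<noteq> 0" using p by auto
    have "cayley p + 1 = 2 / (1 - p)" using p1 by (simp add: cayley_def field_simps)
    then have c2: "(cmod (1 - p))\<^sup>2 * (cmod (cayley p + 1))\<^sup>2 = 4"
      using p1 by (simp add: norm_divide power_divide)
    have c3: "1 - (cmod p)\<^sup>2 = Re (cayley p) * (cmod (1 - p))\<^sup>2"
      using p1 by (simp add: Re_cayley)
    have p2: "0 < 1 - (cmod p)\<^sup>2" using p by (simp add: power_less_one_iff)
    \<comment> \<open>Here 1 - |p|^2 is Re (cayley p) |1 - p|^2 and |1 - p| is 2 / |cayley p + 1|.
      The bound \<open>h\<close> contributes a^(-n) and the bound \<open>c1\<close> contributes a^(2
      n), which together leave a^n.\<close>
    have "4 * a ^ n \<le> (B + 1)\<^sup>2 * (1 - (cmod p)\<^sup>2)"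
    proof -
      have "4 * a ^ n * 1 \<le> 4 * a ^ n * (a ^ n * Re (cayley p))"
        using an h by (intro mult_left_mono) auto
      also have "\<dots> = (1 - (cmod p)\<^sup>2) * (a ^ n * cmod (cayley p + 1))\<^sup>2"
        unfolding c3 c2[symmetric] by (simp add: power2_eq_square algebra_simps)
      also have "\<dots> \<le> (1 - (cmod p)\<^sup>2) * (B + 1)\<^sup>2"
        using c1 p2 an by (intro mult_left_mono power_mono) auto
      finally show ?thesis by (simp add: mult.commute)
    qed
    \<comment> \<open>The quotient in Littlewood's bound equals (1 + |p|)^2 / (1 - |p|^2), which is
      why the square appears.\<close>
    moreover have "(1 + cmod p)\<^sup>2 \<le> 2\<^sup>2" using p by (intro power_mono) auto
    then have "(1 + cmod p)\<^sup>2 * a ^ n \<le> 4 * a ^ n" using an by (intro mult_right_mono) auto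
    ultimately have "(1 + cmod p) * ((1 + cmod p) * a ^ n) \<le> (1 + cmod p) * ((B + 1)\<^sup>2 * (1 - cmod p))"
      by (simp add: power2_eq_square algebra_simps)
    then have "(1 + cmod p) * a ^ n \<le> (B + 1)\<^sup>2 * (1 - cmod p)"
      by (rule mult_left_le_imp_le) (simp add: add_pos_nonneg)
    then have "(1 + cmod p) / (1 - cmod p) \<le> (B + 1)\<^sup>2 * (1 / a ^ n)"
      using p an by (simp add: field_simps)
    then have "sqrt ((1 + cmod p) / (1 - cmod p)) \<le> sqrt ((B + 1)\<^sup>2 * (1 / a ^ n))"
      by (rule real_sqrt_le_mono)
    also have "1 / a ^ n = ((a powr (- 1 / 2)) ^ n)\<^sup>2"
    proof -
      have "(a powr (- 1 / 2))\<^sup>2 = 1 / a"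
        using a by (simp add: power2_eq_square powr_add[symmetric] powr_minus_divide)
      then have "((a powr (- 1 / 2))\<^sup>2) ^ n = (1 / a) ^ n" by (rule arg_cong)
      then show ?thesis by (simp only: power_one_over power_mult[symmetric] mult.commute)
    qed
    also have "sqrt ((B + 1)\<^sup>2 * ((a powr (- 1 / 2)) ^ n)\<^sup>2) = (B + 1) * (a powr (- 1 / 2)) ^ n"
      unfolding power_mult_distrib[symmetric] real_sqrt_abs using B(1) by (intro abs_of_nonneg) simp
    finally have "sqrt ((1 + cmod p) / (1 - cmod p)) * norm f \<le> (B + 1) * (a powr (- 1 / 2)) ^ n * norm f"
      by (rule mult_right_mono) simp
    then show ?thesis
      using norm_comp_op_le[OF selfmap_funpow[OF selfmap], of n f]
      by (simp add: comp_op_funpow[OF selfmap] p_def)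
  qed
  then show thesis by (rule that)
qed

lemma Sp_comp_op_subset: "Sp (comp_op \<phi>) \<subseteq> {z. cmod z \<le> a powr (- 1 / 2)}"
proof
  fix \<mu> assume \<mu>: "\<mu> \<in> Sp (comp_op \<phi>)"
  obtain C where C: "\<And>n f. norm ((comp_op \<phi> ^^ n) f) \<le> C * (a powr (- 1 / 2)) ^ n * norm f"
    using norm_comp_op_funpow_le by blast
  have "\<not> a powr (- 1 / 2) < cmod \<mu>"
    using Neumann_invertible[OF bounded_clinear_comp_op[OF selfmap] C, of \<mu>] \<mu> a by (auto simp: Sp_def)
  then show "\<mu> \<in> {z. cmod z \<le> a powr (- 1 / 2)}" by simp
qed

section \<open>Eigenfunctions and the lower bound for the essential spectrum\<close>

definition linearizer_power :: "complex \<Rightarrow> complex \<Rightarrow> complex" where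
  "linearizer_power s z = (if z \<in> unit_disc then exp (s * Ln (linearizer z)) else 0)"

lemma Ln_linearizer_holomorphic: "(\<lambda>z. Ln (linearizer z)) holomorphic_on unit_disc"
proof (intro holomorphic_intros linearizer_holomorphic)
  show "linearizer z \<notin> \<real>\<^sub>\<le>\<^sub>0" if "z \<in> unit_disc" for z
    using Re_linearizer_pos[OF that] by (auto simp: complex_nonpos_Reals_iff)
qed

text \<open>
  Since \<open>\<bar>arg w\<bar> < \<pi>/2\<close> on the half plane, \<open>\<bar>w\<^sup>s\<bar>\<^sup>2\<close> is dominated by a multiple of \<open>Re (w\<^sup>p)\<close> with
  \<open>p = 2 Re s\<close> when \<open>0 \<le> p < 1\<close>; for \<open>p < 0\<close> it is bounded because \<open>Re w\<close> is bounded below.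
\<close>
lemma in_hardy2_linearizer_power:
  assumes s: "Re s < 1 / 2"
  shows "in_hardy2 (linearizer_power s)"
proof -
  define p where "p = 2 * Re s"
  define W where "W z = Ln (linearizer z)" for z
  have W: "W holomorphic_on unit_disc"
    using Ln_linearizer_holomorphic by (simp add: W_def[abs_def])
  have arg: "\<bar>Im (W z)\<bar> < pi / 2" if "z \<in> unit_disc" for z
    using Re_Ln_pos_lt[of "linearizer z"] Re_linearizer_pos[OF that] unfolding W_def by force
  have hol: "linearizer_power s holomorphic_on unit_disc"
  proof (rule holomorphic_transform)
    show "(\<lambda>z. exp (s * W z)) holomorphic_on unit_disc" by (intro holomorphic_intros W)
  qed (simp add: linearizer_power_def W_def)
  \<comment> \<open>The argument of \<sigma> is below \<pi>/2 in modulus, so the imaginary part of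
    \<open>s\<close> costs at most the factor exp (\<pi> |Im s|).\<close>
  have sq: "(cmod (linearizer_power s z))\<^sup>2 \<le> exp (p * Re (W z)) * exp (pi * \<bar>Im s\<bar>)"
    if z: "z \<in> unit_disc" for z
  proof -
    have "(cmod (linearizer_power s z))\<^sup>2 = exp (2 * Re (s * W z))"
      using z by (simp only: linearizer_power_def W_def if_True norm_exp_eq_Re exp_double)
    also have "\<dots> \<le> exp (p * Re (W z) + pi * \<bar>Im s\<bar>)"
    proof -
      have "- (Im s * Im (W z)) \<le> \<bar>Im s\<bar> * \<bar>Im (W z)\<bar>" by (simp flip: abs_mult)
      also have "\<dots> \<le> \<bar>Im s\<bar> * (pi / 2)" using arg[OF z] by (intro mult_left_mono) auto
      finally show ?thesis by (simp add: p_def algebra_simps)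
    qed
    finally show ?thesis by (simp add: exp_add)
  qed
  have "\<exists>G. G holomorphic_on unit_disc \<and> (\<forall>z\<in>unit_disc. (cmod (linearizer_power s z))\<^sup>2 \<le> Re (G z))"
  proof (cases "Re s \<ge> 0")
    case True
    then have p: "0 \<le> p" "p < 1" using s by (auto simp: p_def)
    \<comment> \<open>The cosine is a lower bound for cos (p arg w) over the half-plane, positive
      because p < 1; this is where Re s < 1/2 enters.\<close>
    define C where "C = exp (pi * \<bar>Im s\<bar>) / cos (p * (pi / 2))"
    have cp: "cos (p * (pi / 2)) > 0"
      using p pi_gt_zero by (intro cos_gt_zero_pi) (auto simp: field_simps intro: less_le_trans[of _ 0])
    then have C: "C > 0" by (simp add: C_def)
    define G where "G z = of_real C * exp (of_real p * W z)" for z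
    have "(cmod (linearizer_power s z))\<^sup>2 \<le> Re (G z)" if z: "z \<in> unit_disc" for z
    proof -
      have "cos (p * (pi / 2)) \<le> cos \<bar>p * Im (W z)\<bar>"
      proof (rule cos_monotone_0_pi_le)
        show "\<bar>p * Im (W z)\<bar> \<le> p * (pi / 2)"
          using p arg[OF z] mult_left_mono[of "\<bar>Im (W z)\<bar>" "pi / 2" p] by (simp add: abs_mult)
        have "p * (pi / 2) \<le> 1 * (pi / 2)" using p by (intro mult_right_mono) auto
        then show "p * (pi / 2) \<le> pi" using pi_gt_zero by simp
      qed simp
      then have "exp (pi * \<bar>Im s\<bar>) \<le> C * cos (p * Im (W z))"
        using cp by (simp add: C_def field_simps)
      then have "exp (p * Re (W z)) * exp (pi * \<bar>Im s\<bar>) \<le> exp (p * Re (W z)) * (C * cos (p * Im (W z)))"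
        by (intro mult_left_mono) auto
      with sq[OF z] have "(cmod (linearizer_power s z))\<^sup>2 \<le> exp (p * Re (W z)) * (C * cos (p * Im (W z)))"
        by (rule order_trans)
      then show ?thesis by (simp add: G_def Re_exp mult_ac)
    qed
    moreover have "G holomorphic_on unit_disc" unfolding G_def by (intro holomorphic_intros W)
    ultimately show ?thesis by blast
  next
    case False
    define G where "G z = complex_of_real (exp (p * ln (a * \<delta>)) * exp (pi * \<bar>Im s\<bar>))" for z :: complex
    have "(cmod (linearizer_power s z))\<^sup>2 \<le> Re (G z)" if z: "z \<in> unit_disc" for z
    proof -
      have "a * \<delta> \<le> cmod (linearizer z)"
        using Re_linearizer_ge[OF z] complex_Re_le_cmod[of "linearizer z"] by simp
      then have "ln (a * \<delta>) \<le> Re (W z)"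
        using a \<delta> Re_linearizer_pos[OF z] unfolding W_def by (subst Re_Ln) (auto intro: ln_mono)
      then have "p * Re (W z) \<le> p * ln (a * \<delta>)" using False by (simp add: p_def mult_left_mono_neg)
      then have "exp (p * Re (W z)) * exp (pi * \<bar>Im s\<bar>) \<le> exp (p * ln (a * \<delta>)) * exp (pi * \<bar>Im s\<bar>)"
        by (intro mult_right_mono) auto
      then show ?thesis using sq[OF z] by (simp only: G_def Re_complex_of_real)
    qed
    moreover have "G holomorphic_on unit_disc" unfolding G_def by (intro holomorphic_intros)
    ultimately show ?thesis by blast
  qed
  then obtain G where "G holomorphic_on unit_disc"
    "\<And>z. z \<in> unit_disc \<Longrightarrow> (cmod (linearizer_power s z))\<^sup>2 \<le> Re (G z)" by blast
  then show ?thesis by (rule in_hardy2I_majorant[OF hol]) (auto simp: linearizer_power_def)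
qed

text \<open>Multiplication by the positive number 1 / a leaves the argument unchanged, so the
  principal logarithm picks up no multiple of 2 \<pi> \<i>.\<close>

lemma Ln_linearizer_comp:
  assumes z: "z \<in> unit_disc"
  shows "Ln (linearizer (\<phi> z)) = Ln (linearizer z) - of_real (ln a)"
proof -
  have "linearizer z \<noteq> 0" using Re_linearizer_pos[OF z] by auto
  then have "Ln (of_real (1 / a) * linearizer z) = of_real (ln (1 / a)) + Ln (linearizer z)"
    using a Ln_of_real[of "1 / a"] by (subst Ln_times_of_real) auto
  then show ?thesis
    unfolding linearizer_comp[OF z] using a by (simp add: ln_div)
qed

text \<open>Supplies the infinitely many points at which a polynomial relation between
  eigenfunctions must hold. A finite connected image is a single value, which confines
  \<open>Ln (linearizer z)\<close> to a countable set; a connected countable set has at most one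
  point, yet 0 and \<phi>(0) give different logarithms.\<close>

lemma infinite_periodic_image:
  "infinite ((\<lambda>z. exp (2 * pi * \<i> / of_real (ln a) * Ln (linearizer z))) ` unit_disc)"
proof
  define c where "c = 2 * pi * \<i> / of_real (ln a)"
  define W where "W z = Ln (linearizer z)" for z
  have la: "ln a < 0" using a by simp
  assume "finite ((\<lambda>z. exp (2 * pi * \<i> / of_real (ln a) * Ln (linearizer z))) ` unit_disc)"
  then have fin: "finite ((\<lambda>z. exp (c * W z)) ` unit_disc)" by (simp add: c_def W_def)
  have W: "continuous_on unit_disc W"
    using holomorphic_on_imp_continuous_on[OF Ln_linearizer_holomorphic] by (simp add: W_def[abs_def])
  then have "connected ((\<lambda>z. exp (c * W z)) ` unit_disc)"
    by (intro connected_continuous_image continuous_intros) auto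
  with fin have "\<exists>v. (\<lambda>z. exp (c * W z)) ` unit_disc = {v}"
    by (subst (asm) connected_finite_iff_sing) auto
  then have const: "exp (c * W z) = exp (c * W 0)" if "z \<in> unit_disc" for z
    using that by (metis (no_types, lifting) centre_in_ball imageI singletonD zero_less_one)
  have "W ` unit_disc \<subseteq> range (\<lambda>n::int. W 0 + of_int n * of_real (ln a))"
  proof
    fix w assume "w \<in> W ` unit_disc"
    then obtain z where z: "z \<in> unit_disc" "w = W z" by blast
    obtain n :: int where "c * W z = c * W 0 + of_int (2 * n) * pi * \<i>"
      using const[OF z(1)] unfolding exp_eq by (auto simp: mult_ac)
    also have "\<dots> = c * (W 0 + of_int n * of_real (ln a))"
      using la by (simp add: c_def field_simps)
    finally have "W z = W 0 + of_int n * of_real (ln a)"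
      using la by (simp add: c_def)
    then show "w \<in> range (\<lambda>n::int. W 0 + of_int n * of_real (ln a))" using z by blast
  qed
  then have "countable (W ` unit_disc)" by (rule countable_subset) simp
  moreover have "connected (W ` unit_disc)" using W by (intro connected_continuous_image) auto
  moreover have "W (\<phi> 0) \<in> W ` unit_disc" "W 0 \<in> W ` unit_disc"
    using selfmap_in_disc[OF selfmap, of 0] by auto
  moreover have "W (\<phi> 0) \<noteq> W 0" using Ln_linearizer_comp[of 0] la by (simp add: W_def)
  ultimately show False using connected_uncountable by blast
qed

lemma eigenspace_infinite_dim:
  assumes \<mu>: "\<mu> \<noteq> 0" "cmod \<mu> < a powr (- 1 / 2)" and B: "finite B"
  shows "\<not> {f. comp_op \<phi> f = \<mu> *\<^sub>C f} \<subseteq> cspan B"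
proof
  assume sub: "{f. comp_op \<phi> f = \<mu> *\<^sub>C f} \<subseteq> cspan B"
  define \<kappa> where "\<kappa> = - ln a"
  have \<kappa>: "\<kappa> > 0" using a by (simp add: \<kappa>_def)
  \<comment> \<open>These exponents solve exp (s \<kappa>) = \<mu>. Their differences are imaginary,
    so Re (s k) = ln |\<mu>| / \<kappa> stays below 1/2 for every \<open>k\<close>.\<close>
  define s where "s k = (Ln \<mu> - 2 * pi * \<i> * of_nat k) / of_real \<kappa>" for k :: nat
  have "ln (cmod \<mu>) < ln (a powr (- 1 / 2))"
    using \<mu> a by (subst ln_less_cancel_iff) auto
  then have "ln (cmod \<mu>) < \<kappa> / 2" using a by (simp add: ln_powr \<kappa>_def)
  then have s: "Re (s k) < 1 / 2" for k
    using \<mu> \<kappa> by (simp add: s_def Re_divide_of_real field_simps)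
  define F where "F k = Abs_hardy2 (linearizer_power (s k))" for k
  have F: "fun_of (F k) = linearizer_power (s k)" for k
    using in_hardy2_linearizer_power[OF s] by (simp add: F_def Abs_hardy2_inverse)
  \<comment> \<open>\<open>V\<close> is \<sigma> to the power 2 \<pi> \<i> / ln a and is invariant
    under \<phi>. The eigenfunctions are \<open>E\<close> times powers of \<open>V\<close>, so their
    independence reduces to a nonzero polynomial having finitely many roots.\<close>
  define V where "V z = exp (2 * pi * \<i> / of_real (ln a) * Ln (linearizer z))" for z
  define E where "E z = exp (Ln \<mu> / of_real \<kappa> * Ln (linearizer z))" for z
  have FV: "fun_of (F k) z = E z * V z ^ k" if "z \<in> unit_disc" for k z
  proof -
    have "s k * Ln (linearizer z) = Ln \<mu> / of_real \<kappa> * Ln (linearizer z)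
        + of_nat k * (2 * pi * \<i> / of_real (ln a) * Ln (linearizer z))"
      using \<kappa> by (simp add: s_def \<kappa>_def field_simps)
    then show ?thesis
      using that by (simp only: F linearizer_power_def if_True E_def V_def exp_add exp_of_nat_mult)
  qed
  have eig: "comp_op \<phi> (F k) = \<mu> *\<^sub>C F k" for k
  proof (rule hardy2_eqI)
    fix z :: complex assume z: "z \<in> unit_disc"
    have "s k * of_real \<kappa> = Ln \<mu> - 2 * pi * \<i> * of_nat k" using \<kappa> by (simp add: s_def)
    then have "exp (s k * of_real \<kappa>) = \<mu> / exp (of_nat k * (2 * pi * \<i>))"
      using \<mu> by (simp add: exp_diff mult_ac)
    also have "exp (of_nat k * (2 * pi * \<i>)) = 1"
      unfolding exp_of_nat_mult by (simp add: exp_two_pi_i' mult_ac)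
    finally have "exp (s k * of_real \<kappa>) = \<mu>" by simp
    then have "exp (s k * (Ln (linearizer z) - of_real (ln a))) = \<mu> * exp (s k * Ln (linearizer z))"
      by (simp add: \<kappa>_def algebra_simps exp_diff exp_minus divide_inverse)
    then show "fun_of (comp_op \<phi> (F k)) z = fun_of (\<mu> *\<^sub>C F k) z"
      using z selfmap_in_disc[OF selfmap z]
      by (simp add: fun_of_comp_op[OF selfmap] scaleC_hardy2.rep_eq F linearizer_power_def Ln_linearizer_comp)
  qed
  have span_poly: "\<exists>p. (\<forall>i\<ge>n. coeff p i = 0) \<and> (\<forall>z\<in>unit_disc. fun_of g z = E z * poly p (V z))"
    if "g \<in> cspan (F ` {..<n})" for g n
    using that
  proof (induction rule: complex_vector.span_induct_alt)
    case base
    show ?case by (rule exI[of _ 0]) (simp add: zero_hardy2.rep_eq)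
  next
    case (step c x y)
    then obtain k p where k: "k < n" "x = F k" and p: "\<forall>i\<ge>n. coeff p i = 0"
      "\<forall>z\<in>unit_disc. fun_of y z = E z * poly p (V z)" by blast
    show ?case
      by (rule exI[of _ "monom c k + p"])
        (use k p in \<open>auto simp: fun_of_add scaleC_hardy2.rep_eq FV poly_monom algebra_simps\<close>)
  qed
  have new: "F n \<notin> cspan (F ` {..<n})" for n
  proof
    assume "F n \<in> cspan (F ` {..<n})"
    then obtain p where p: "\<forall>i\<ge>n. coeff p i = 0"
      "\<And>z. z \<in> unit_disc \<Longrightarrow> fun_of (F n) z = E z * poly p (V z)" using span_poly by blast
    have "V ` unit_disc \<subseteq> {v. poly (monom 1 n - p) v = 0}"
      using p(2) FV by (auto simp: poly_monom E_def)
    then have "infinite {v. poly (monom 1 n - p) v = 0}"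
      using infinite_periodic_image infinite_super unfolding V_def by blast
    then have "monom 1 n - p = 0" using poly_roots_finite by blast
    then have "coeff p n = 1" by (metis coeff_monom eq_iff_diff_eq_0)
    then show False using p(1) by simp
  qed
  have indep: "\<not> complex_vector.dependent (F ` {..<n}) \<and> card (F ` {..<n}) = n" for n
  proof (induction n)
    case 0
    show ?case by (simp add: complex_vector.independent_empty)
  next
    case (Suc n)
    have "F n \<notin> F ` {..<n}" by (rule contra_subsetD[OF complex_vector.span_superset new])
    moreover have "\<not> complex_vector.dependent (insert (F n) (F ` {..<n}))"
      by (rule complex_vector.independent_insertI[OF new conjunct1[OF Suc]])
    ultimately show ?case using Suc by (simp add: lessThan_Suc)
  qed
  have "F ` {..<Suc (card B)} \<subseteq> cspan B"
  proof
    fix f assume "f \<in> F ` {..<Suc (card B)}"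
    then obtain k where "f = F k" by (rule imageE)
    then show "f \<in> cspan B" using sub eig[of k] by (simp only: subset_iff mem_Collect_eq)
  qed
  then have "card (F ` {..<Suc (card B)}) \<le> card B"
    using complex_vector.independent_span_bound[OF B conjunct1[OF indep]] by blast
  then show False using indep[of "Suc (card B)"] by simp
qed

lemma disc_subset_Sp_ess_comp_op: "{z. cmod z \<le> a powr (- 1 / 2)} \<subseteq> Sp_ess (comp_op \<phi>)"
proof
  fix \<mu> assume "\<mu> \<in> {z. cmod z \<le> a powr (- 1 / 2)}"
  then have \<mu>: "cmod \<mu> \<le> a powr (- 1 / 2)" by simp
  show "\<mu> \<in> Sp_ess (comp_op \<phi>)"
    unfolding Sp_ess_def
  proof (rule CollectI, rule notI)
    assume "Fredholm (op_minus (comp_op \<phi>) \<mu>)"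
    then obtain e where e: "e > 0"
      "\<And>\<nu>. cmod (\<nu> - \<mu>) < e \<Longrightarrow> \<exists>B. finite B \<and> {f. comp_op \<phi> f = \<nu> *\<^sub>C f} \<subseteq> cspan B"
      using Fredholm_imp_nearby_kernels_finite_dim by blast
    define R where "R = a powr (- 1 / 2)"
    have R: "R > 0" using a by (simp add: R_def)
    \<comment> \<open>Infinite-dimensional eigenspaces are known for 0 < |\<nu>| < R; every point of
      the closed disc, including its centre and its boundary, has such a \<nu> within
      \<open>e\<close>.\<close>
    have "\<exists>\<nu>. \<nu> \<noteq> 0 \<and> cmod \<nu> < R \<and> cmod (\<nu> - \<mu>) < e"
    proof (cases "\<mu> = 0")
      case True
      then show ?thesis
        using R e by (intro exI[of _ "of_real (min R e / 2)"]) (auto simp: min_def)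
    next
      case False
      \<comment> \<open>Shrinking \<mu> by the factor 1 - t moves it by at most e / 2, and t \<le>
        1/2 keeps the result nonzero.\<close>
      define t where "t = min (1/2) (e / (2 * cmod \<mu>))"
      have t: "0 < t" "t \<le> 1/2" "t * cmod \<mu> \<le> e / 2"
        using e False by (auto simp: t_def min_def field_simps)
      have "cmod (of_real (1 - t) * \<mu>) = (1 - t) * cmod \<mu>"
        using t by (simp only: norm_mult norm_of_real)
      also have "\<dots> < 1 * cmod \<mu>" using t False by (intro mult_strict_right_mono) auto
      finally have "cmod (of_real (1 - t) * \<mu>) < R" using \<mu> by (simp add: R_def)
      moreover have "of_real (1 - t) * \<mu> - \<mu> = - (of_real t * \<mu>)" by (simp add: algebra_simps)
      then have "cmod (of_real (1 - t) * \<mu> - \<mu>) = t * cmod \<mu>"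
        using t by (simp add: norm_mult)
      moreover have "complex_of_real (1 - t) * \<mu> \<noteq> 0"
        unfolding mult_eq_0_iff of_real_eq_0_iff using t False by auto
      ultimately show ?thesis using t e by (intro exI[of _ "of_real (1 - t) * \<mu>"]) auto
    qed
    then show False using e(2) eigenspace_infinite_dim unfolding R_def by blast
  qed
qed

end

theorem theorem4p1:
  fixes \<phi> :: "complex \<Rightarrow> complex"
  assumes "essentially_linear_fractional \<phi>"
    and "hyperbolic_type \<phi>"
    and "denjoy_wolff_point \<phi> 1"
  shows "Sp (comp_op \<phi>) = Sp_ess (comp_op \<phi>) \<and>
    Sp_ess (comp_op \<phi>) = {z. cmod z \<le> Re (boundary_value (deriv \<phi>) 1) powr (- 1 / 2)}"
proof -
  obtain a K \<rho> \<delta> where model: "hyperbolic_model \<phi> a K \<rho> \<delta>"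
    and bv: "boundary_value (deriv \<phi>) 1 = of_real a"
    by (rule elf_hyperbolic_imp_model[OF assms])
  interpret hyperbolic_model \<phi> a K \<rho> \<delta> by (rule model)
  \<comment> \<open>This closes the cycle of inclusions from \<open>Sp\<close> to the closed disc to
    \<open>Sp_ess\<close> and back to \<open>Sp\<close>, so all three sets agree.\<close>
  have "Sp_ess (comp_op \<phi>) \<subseteq> Sp (comp_op \<phi>)"
    using op_invertible_imp_Fredholm by (auto simp: Sp_def Sp_ess_def)
  then show ?thesis
    using Sp_comp_op_subset disc_subset_Sp_ess_comp_op unfolding bv Re_complex_of_real by blast
qed

end
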